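(* Assume that $B(x)=\delta_0(x)$, that is, $W(t,x)=w(t,x)$, $x\in\mathbb{Z}^d$, are i.i.d. Wiener processes, and let $\mathcal{H}_2=2\varkappa\mathcal{A}+\delta_0(x)$. If $\int_{T^d}\frac{dk}{1-\hat a(k)}<\infty$, i.e. the random walk $x(t)$ with generator $2\varkappa\mathcal{A}$ is transient, then there exists a critical value $\varkappa_{cr}$ such that $\lambda_0(\mathcal{H}_2)>0$ for $\varkappa<\varkappa_{cr}$ and $\lambda_0(\mathcal{H}_2)=0$ for $\varkappa>\varkappa_{cr}$.
   Context: $\varkappa>0$. The kernel $a:\mathbb{Z}^d\to[0,\infty)$ satisfies $a(z)=a(-z)$, $a(0)=0$, $a(z)>0$ if $|z|=1$, $\sum_za(z)=1$; $\mathcal{A}f(x)=\sum_{z\ne0}a(z)(f(x+z)-f(x))$ is a bounded self-adjoint operator on $l^2(\mathbb{Z}^d)$. $\hat a(k)=\sum_za(z)\cos(k\cdot z)$, $k\in T^d=[-\pi,\pi]^d$. $\lambda_0(\mathcal{H}_2)$ is the maximum point of the spectrum of $\mathcal{H}_2$ on $l^2(\mathbb{Z}^d)$; $\delta_0(x)$ acts as multiplication by the indicator of $\{0\}$. The walk is transient if $G_0(0,0)=\int_0^\infty p(t,0,0)dt<\infty$, where $p(t,x,y)$ is its transition probability. *)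

theory Defs
  imports "HOL-Analysis.Analysis"
begin

(* The lattice Z^d is int ^ 'n with d = CARD('n) >= 1. *)

definition lattice_vec :: "int ^ 'n \<Rightarrow> real ^ 'n" where
  "lattice_vec z = (\<chi> i. real_of_int (z $ i))"

definition walk_op :: "(int ^ 'n \<Rightarrow> real) \<Rightarrow> (int ^ 'n \<Rightarrow> 'b::real_normed_vector) \<Rightarrow> int ^ 'n \<Rightarrow> 'b" where
  "walk_op a f x = (\<Sum>\<^sub>\<infinity>z\<in>- {0}. a z *\<^sub>R (f (x + z) - f x))"

definition schroedinger_op ::
    "real \<Rightarrow> (int ^ 'n \<Rightarrow> real) \<Rightarrow> (int ^ 'n \<Rightarrow> real) \<Rightarrow> (int ^ 'n \<Rightarrow> complex) \<Rightarrow> int ^ 'n \<Rightarrow> complex" where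
  "schroedinger_op \<kappa> a B f x = (2 * \<kappa>) *\<^sub>R walk_op a f x + B x *\<^sub>R f x"

definition l2 :: "('i \<Rightarrow> complex) set" where
  "l2 = {f. (\<lambda>x. (cmod (f x))\<^sup>2) summable_on UNIV}"

definition l2_norm :: "('i \<Rightarrow> complex) \<Rightarrow> real" where
  "l2_norm f = sqrt (\<Sum>\<^sub>\<infinity>x. (cmod (f x))\<^sup>2)"

(* The complement of the resolvent set: z is a regular point iff T - z maps l2 bijectively
   onto l2 with bounded inverse. Operators are given as maps on all functions; only their
   restriction to l2 matters here. *)
definition l2_spectrum :: "(('i \<Rightarrow> complex) \<Rightarrow> 'i \<Rightarrow> complex) \<Rightarrow> complex set" where
  "l2_spectrum T = {z. \<not> (bij_betw (\<lambda>f x. T f x - z * f x) l2 l2 \<and>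
     (\<exists>C. \<forall>f\<in>l2. l2_norm f \<le> C * l2_norm (\<lambda>x. T f x - z * f x)))}"

(* The maximum is required to be attained; it is unspecified if there is none. *)
definition spectrum_max :: "(('i \<Rightarrow> complex) \<Rightarrow> 'i \<Rightarrow> complex) \<Rightarrow> real" where
  "spectrum_max T = (GREATEST s. complex_of_real s \<in> l2_spectrum T)"

definition a_hat :: "(int ^ 'n \<Rightarrow> real) \<Rightarrow> real ^ 'n \<Rightarrow> real" where
  "a_hat a k = (\<Sum>\<^sub>\<infinity>z. a z * cos (k \<bullet> lattice_vec z))"

definition torus :: "(real ^ 'n) set" where
  "torus = cbox (\<chi> i. - pi) (\<chi> i. pi)"

(* The quotient is taken in ennreal, so the integrand is infinite where a_hat a k = 1. *)
definition torus_integral :: "(int ^ 'n \<Rightarrow> real) \<Rightarrow> ennreal" where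
  "torus_integral a = (\<integral>\<^sup>+k\<in>torus. 1 / ennreal (1 - a_hat a k) \<partial>lborel)"

(* p(t,x,y) = (exp(t L) delta_y)(x) for the generator L = 2 \<kappa> A, which is bounded
   in the supremum norm, so that the exponential series converges. *)
definition transition_prob ::
    "real \<Rightarrow> (int ^ 'n \<Rightarrow> real) \<Rightarrow> real \<Rightarrow> int ^ 'n \<Rightarrow> int ^ 'n \<Rightarrow> real" where
  "transition_prob \<kappa> a t x y =
     (\<Sum>m. t ^ m / fact m * ((\<lambda>f u. 2 * \<kappa> * walk_op a f u) ^^ m) (indicator {y}) x)"

definition transient :: "real \<Rightarrow> (int ^ 'n \<Rightarrow> real) \<Rightarrow> bool" where
  "transient \<kappa> a \<longleftrightarrow> (\<integral>\<^sup>+t\<in>{0..}. ennreal (transition_prob \<kappa> a t 0 0) \<partial>lborel) < \<infinity>"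

end

theory Submission
  imports Defs "HOL-Probability.Probability_Measure" "HOL-Real_Asymp.Real_Asymp"
begin

text \<open>
  Write \<open>q = 2\<kappa>\<close> and \<open>\<delta>\<^sub>0\<close> for the indicator of the origin. The operator
  \<open>H = q walk_op a + \<delta>\<^sub>0\<close> is a perturbation of rank one of the generator of the walk. For \<open>\<mu> > 0\<close> let \<open>u\<close> be the resolvent
  \<open>(\<mu> - q walk_op a)\<^sup>-\<^sup>1\<close> applied to \<open>\<delta>\<^sub>0\<close>. Solving \<open>(H - \<mu>) f = h\<close> reduces to a scalar equation
  for \<open>f 0\<close> with coefficient \<open>1 - u 0\<close>, so \<open>\<mu>\<close> belongs to the spectrum of \<open>H\<close> if and only if
  \<open>u 0 = 1\<close> (\<open>spectrum_iff\<close>). The resolvent itself comes from a fixed-point iteration: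
  one step of the walk, \<open>avg\<close>, increases neither the supremum norm nor, by Jensen's inequality,
  the norm of \<open>l2\<close> (\<open>resolvent_exists\<close>).

  On the Fourier side \<open>walk_op a\<close> is multiplication by \<open>a_hat a - 1\<close>. Hence \<open>u 0\<close> is the mean
  \<open>green q \<mu>\<close> over the torus of \<open>1 / (\<mu> + q (1 - a_hat a))\<close> (\<open>green_solution\<close>), which is continuous
  and strictly decreasing in \<open>\<mu>\<close>, is at most \<open>1 / \<mu>\<close>, and increases to \<open>g / q\<close> as \<open>\<mu>\<close> decreases
  to 0, where \<open>g\<close> is the mean of \<open>1 / (1 - a_hat a)\<close>. Let \<open>g\<close> be finite. If \<open>q < g\<close>, the equation
  \<open>green q \<mu> = 1\<close> has exactly one positive solution, the maximum of the spectrum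
  (\<open>spectrum_max_subcritical\<close>). If \<open>q > g\<close>, it has none, and the maximum is 0
  (\<open>spectrum_max_supercritical\<close>), because 0 always belongs to the spectrum: indicators of large cubes
  that avoid the origin are approximate eigenfunctions (\<open>zero_in_spectrum\<close>). The critical value is
  therefore \<open>g / 2\<close>.

  The return probability at time \<open>t\<close> is the mean of \<open>exp (- t q (1 - a_hat a))\<close>; integration
  over \<open>t\<close> gives the mean of \<open>1 / (q (1 - a_hat a))\<close>, whence the characterization of transience
  (\<open>transient_iff\<close>).
\<close>

section \<open>Square-summable functions through finite partial sums\<close>

text \<open>Bounds on \<open>l2_norm\<close> are always obtained from uniform bounds on the sums over finite
  sets. The parallelogram-type estimate \<open>cmod_add_squared_le\<close> replaces the triangle inequality,
  because only the existence of constants matters.\<close>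

lemma l2I:
  fixes f :: "'i \<Rightarrow> complex"
  assumes "\<And>F. finite F \<Longrightarrow> (\<Sum>x\<in>F. (cmod (f x))\<^sup>2) \<le> S"
  shows "f \<in> l2" and "(l2_norm f)\<^sup>2 \<le> S"
proof -
  have *: "(\<lambda>x. (cmod (f x))\<^sup>2) summable_on UNIV"
    by (rule nonneg_bdd_above_summable_on) (auto intro!: bdd_aboveI[of _ S] assms)
  then show "f \<in> l2" by (simp add: l2_def)
  have "(\<Sum>\<^sub>\<infinity>x. (cmod (f x))\<^sup>2) \<le> S"
    by (rule infsum_le_finite_sums[OF *]) (use assms in auto)
  then show "(l2_norm f)\<^sup>2 \<le> S"
    by (simp add: l2_norm_def infsum_nonneg)
qed

lemma l2_norm_nonneg [simp]: "0 \<le> l2_norm f"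
  by (simp add: l2_norm_def infsum_nonneg)

lemma sum_le_l2_norm:
  assumes "f \<in> l2" "finite F"
  shows "(\<Sum>x\<in>F. (cmod (f x))\<^sup>2) \<le> (l2_norm f)\<^sup>2"
proof -
  have "(\<Sum>x\<in>F. (cmod (f x))\<^sup>2) \<le> (\<Sum>\<^sub>\<infinity>x. (cmod (f x))\<^sup>2)"
    using assms by (intro finite_sum_le_infsum) (auto simp: l2_def)
  then show ?thesis by (simp add: l2_norm_def infsum_nonneg)
qed

lemma norm_le_l2_norm: "f \<in> l2 \<Longrightarrow> cmod (f x) \<le> l2_norm f"
  using sum_le_l2_norm[of f "{x}"] by (auto intro: power2_le_imp_le)

lemma sum_shift_le_l2_norm:
  fixes f :: "'a::group_add \<Rightarrow> complex"
  assumes "f \<in> l2" "finite F"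
  shows "(\<Sum>x\<in>F. (cmod (f (x + z)))\<^sup>2) \<le> (l2_norm f)\<^sup>2"
proof -
  have "(\<Sum>x\<in>F. (cmod (f (x + z)))\<^sup>2) = (\<Sum>x\<in>(\<lambda>x. x + z) ` F. (cmod (f x))\<^sup>2)"
    by (subst sum.reindex) (auto simp: inj_on_def)
  also have "\<dots> \<le> (l2_norm f)\<^sup>2" using assms by (intro sum_le_l2_norm) auto
  finally show ?thesis .
qed

lemma cmod_add_squared_le: "(cmod (u + v))\<^sup>2 \<le> 2 * (cmod u)\<^sup>2 + 2 * (cmod v)\<^sup>2"
proof -
  have "(cmod (u + v))\<^sup>2 \<le> (cmod u + cmod v)\<^sup>2"
    by (intro power_mono norm_triangle_ineq) auto
  also have "\<dots> \<le> 2 * (cmod u)\<^sup>2 + 2 * (cmod v)\<^sup>2"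
    using sum_squares_bound[of "cmod u" "cmod v"] by (simp add: power2_sum)
  finally show ?thesis .
qed

lemma l2_add:
  assumes "f \<in> l2" "g \<in> l2"
  shows "(\<lambda>x. f x + g x) \<in> l2"
    and "(l2_norm (\<lambda>x. f x + g x))\<^sup>2 \<le> 2 * (l2_norm f)\<^sup>2 + 2 * (l2_norm g)\<^sup>2"
proof -
  have *: "(\<Sum>x\<in>F. (cmod (f x + g x))\<^sup>2) \<le> 2 * (l2_norm f)\<^sup>2 + 2 * (l2_norm g)\<^sup>2"
    if "finite F" for F
  proof -
    have "(\<Sum>x\<in>F. (cmod (f x + g x))\<^sup>2) \<le> (\<Sum>x\<in>F. 2 * (cmod (f x))\<^sup>2 + 2 * (cmod (g x))\<^sup>2)"
      by (intro sum_mono cmod_add_squared_le)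
    also have "\<dots> = 2 * (\<Sum>x\<in>F. (cmod (f x))\<^sup>2) + 2 * (\<Sum>x\<in>F. (cmod (g x))\<^sup>2)"
      by (simp add: sum.distrib sum_distrib_left)
    also have "\<dots> \<le> 2 * (l2_norm f)\<^sup>2 + 2 * (l2_norm g)\<^sup>2"
      using sum_le_l2_norm[OF assms(1) that] sum_le_l2_norm[OF assms(2) that] by simp
    finally show ?thesis .
  qed
  from l2I[OF *] show "(\<lambda>x. f x + g x) \<in> l2"
    and "(l2_norm (\<lambda>x. f x + g x))\<^sup>2 \<le> 2 * (l2_norm f)\<^sup>2 + 2 * (l2_norm g)\<^sup>2" by auto
qed

lemma l2_cmult:
  assumes "f \<in> l2"
  shows "(\<lambda>x. c * f x) \<in> l2" and "(l2_norm (\<lambda>x. c * f x))\<^sup>2 \<le> (cmod c)\<^sup>2 * (l2_norm f)\<^sup>2"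
proof -
  have *: "(\<Sum>x\<in>F. (cmod (c * f x))\<^sup>2) \<le> (cmod c)\<^sup>2 * (l2_norm f)\<^sup>2" if "finite F" for F
    using sum_le_l2_norm[OF assms that]
    by (simp add: norm_mult power_mult_distrib sum_distrib_left[symmetric] mult_left_mono)
  from l2I[OF *] show "(\<lambda>x. c * f x) \<in> l2"
    and "(l2_norm (\<lambda>x. c * f x))\<^sup>2 \<le> (cmod c)\<^sup>2 * (l2_norm f)\<^sup>2" by auto
qed

lemma indicator_l2:
  assumes "finite S"
  shows "(indicator S :: 'i \<Rightarrow> complex) \<in> l2"
    and "(l2_norm (indicator S :: 'i \<Rightarrow> complex))\<^sup>2 = real (card S)"
proof -
  have *: "(cmod (indicator S x))\<^sup>2 = (indicator S x :: real)" for x :: 'i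
    by (auto simp: indicator_def)
  have bound: "(\<Sum>x\<in>F. (cmod (indicator S x))\<^sup>2) \<le> real (card S)" if "finite F" for F :: "'i set"
  proof -
    have "(\<Sum>x\<in>F. (cmod (indicator S x))\<^sup>2) = (\<Sum>x\<in>F. indicator S x)"
      by (simp only: *)
    also have "\<dots> = real (card (F \<inter> S))"
      using that by (simp add: indicator_def)
    finally show ?thesis using assms by (simp add: card_mono)
  qed
  show in_l2: "(indicator S :: 'i \<Rightarrow> complex) \<in> l2" using l2I(1)[OF bound] .
  have "real (card S) \<le> (l2_norm (indicator S :: 'i \<Rightarrow> complex))\<^sup>2"
    using sum_le_l2_norm[OF in_l2 assms] assms by (simp add: *)
  then show "(l2_norm (indicator S :: 'i \<Rightarrow> complex))\<^sup>2 = real (card S)"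
    using l2I(2)[OF bound] by simp
qed

lemma has_sum_finite_sum:
  fixes f :: "'i \<Rightarrow> 'j \<Rightarrow> real"
  assumes "\<And>x. x \<in> F \<Longrightarrow> (f x has_sum s x) A"
  shows "((\<lambda>z. \<Sum>x\<in>F. f x z) has_sum (\<Sum>x\<in>F. s x)) A"
  using assms by (induction F rule: infinite_finite_induct) (auto intro!: has_sum_add)

section \<open>The averaging operator\<close>

text \<open>A symmetric probability distribution \<open>a\<close> on the lattice, the law of one jump of the
  walk. Symmetry makes its Fourier transform real. Jumps of length 0 are permitted; they do
  not contribute to \<open>walk_op\<close>.\<close>

locale walk_kernel =
  fixes a :: "int ^ 'n \<Rightarrow> real"
  assumes a_nonneg: "a z \<ge> 0"
    and a_sym: "a (- z) = a z"
    and a_sum: "(a has_sum 1) UNIV"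
begin

text \<open>One step of the random walk, acting on functions: the bounded operator for which
  \<open>walk_op\<close> is the difference to the identity.\<close>

definition avg :: "(int ^ 'n \<Rightarrow> 'b::real_normed_vector) \<Rightarrow> int ^ 'n \<Rightarrow> 'b" where
  "avg f x = (\<Sum>\<^sub>\<infinity>z. a z *\<^sub>R f (x + z))"

lemma a_summable: "a summable_on UNIV"
  using a_sum by (rule has_sum_imp_summable)

lemma a_abs_summable: "(\<lambda>z. norm (a z)) summable_on UNIV"
  using a_summable a_nonneg by (simp add: abs_of_nonneg)

lemma bounded_a_summable:
  fixes g :: "int ^ 'n \<Rightarrow> 'b::banach"
  assumes "\<And>z. norm (g z) \<le> M"
  shows "(\<lambda>z. a z *\<^sub>R g z) summable_on UNIV"
proof (rule Infinite_Sum.abs_summable_summable, rule Infinite_Sum.abs_summable_on_comparison_test[where g="\<lambda>z. M * a z"])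
  show "(\<lambda>z. norm (M * a z)) summable_on UNIV"
    using summable_on_cmult_right[OF a_abs_summable, of "\<bar>M\<bar>"] by (simp add: abs_mult)
  fix z
  have "norm (a z *\<^sub>R g z) = a z * norm (g z)" using a_nonneg by simp
  also have "\<dots> \<le> a z * M" using a_nonneg assms by (intro mult_left_mono) auto
  finally show "norm (a z *\<^sub>R g z) \<le> norm (M * a z)"
    by (simp add: mult.commute order_trans[OF _ abs_ge_self])
qed

lemma avg_has_sum:
  fixes f :: "int ^ 'n \<Rightarrow> 'b::banach"
  assumes "\<And>z. norm (f z) \<le> M"
  shows "((\<lambda>z. a z *\<^sub>R f (x + z)) has_sum avg f x) UNIV"
  unfolding avg_def by (intro has_sum_infsum bounded_a_summable[of _ M] assms)

lemma a_cmult_has_sum: "((\<lambda>z. a z *\<^sub>R c) has_sum c) UNIV" for c :: "'b::banach"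
  using has_sum_bounded_linear[OF bounded_linear_scaleR_left[of c] a_sum] by simp

lemma avg_bound:
  fixes f :: "int ^ 'n \<Rightarrow> 'b::banach"
  assumes "\<And>z. norm (f z) \<le> M"
  shows "norm (avg f x) \<le> M"
proof -
  have M: "((\<lambda>z. a z * M) has_sum M) UNIV" using a_cmult_has_sum[of M] by simp
  show ?thesis
    using a_nonneg assms by (intro norm_infsum_le[OF avg_has_sum[OF assms] M]) (simp add: mult_left_mono)
qed

lemma avg_lincomb:
  fixes f g :: "int ^ 'n \<Rightarrow> complex"
  assumes "\<And>z. norm (f z) \<le> M" "\<And>z. norm (g z) \<le> N"
  shows "avg (\<lambda>z. c * f z + d * g z) x = c * avg f x + d * avg g x"
proof -
  have "((\<lambda>z. c * (a z *\<^sub>R f (x + z)) + d * (a z *\<^sub>R g (x + z)))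
          has_sum (c * avg f x + d * avg g x)) UNIV"
    by (intro has_sum_add has_sum_cmult_right avg_has_sum[OF assms(1)] avg_has_sum[OF assms(2)])
  also have "(\<lambda>z. c * (a z *\<^sub>R f (x + z)) + d * (a z *\<^sub>R g (x + z)))
      = (\<lambda>z. a z *\<^sub>R (c * f (x + z) + d * g (x + z)))"
    by (simp add: scaleR_add_right)
  finally show ?thesis unfolding avg_def by (rule infsumI)
qed

lemma walk_op_eq:
  fixes f :: "int ^ 'n \<Rightarrow> 'b::banach"
  assumes "\<And>z. norm (f z) \<le> M"
  shows "walk_op a f x = avg f x - f x"
proof -
  have "((\<lambda>z. a z *\<^sub>R f (x + z) + - (a z *\<^sub>R f x)) has_sum (avg f x + - f x)) UNIV"
    using a_cmult_has_sum[of "f x"]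
    by (intro has_sum_add avg_has_sum[where M=M] assms) (simp add: has_sum_uminus)
  then have "((\<lambda>z. a z *\<^sub>R (f (x + z) - f x)) has_sum (avg f x - f x)) UNIV"
    by (simp add: scaleR_diff_right)
  then have "((\<lambda>z. a z *\<^sub>R (f (x + z) - f x)) has_sum (avg f x - f x)) (- {0})"
    by (rule iffD1[OF has_sum_cong_neutral, rotated 3]) auto
  then show ?thesis unfolding walk_op_def by (rule infsumI)
qed

text \<open>Jensen's inequality for the probability weights \<open>a\<close>, in the form
  \<open>E X\<^sup>2 - (E X)\<^sup>2 = E (X - E X)\<^sup>2 \<ge> 0\<close>.\<close>

lemma weighted_Jensen:
  fixes g :: "int ^ 'n \<Rightarrow> complex"
  assumes bd: "\<And>z. norm (g z) \<le> M"
  shows "(norm (\<Sum>\<^sub>\<infinity>z. a z *\<^sub>R g z))\<^sup>2 \<le> (\<Sum>\<^sub>\<infinity>z. a z * (norm (g z))\<^sup>2)"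
proof -
  define m where "m = (\<Sum>\<^sub>\<infinity>z. a z * norm (g z))"
  have bd2: "norm ((norm (g z))\<^sup>2) \<le> M\<^sup>2" for z
    using power_mono[OF bd[of z]] by simp
  have s1: "((\<lambda>z. a z * norm (g z)) has_sum m) UNIV"
    unfolding m_def using bounded_a_summable[of "\<lambda>z. norm (g z)" M] bd by simp
  have s2: "((\<lambda>z. a z * (norm (g z))\<^sup>2) has_sum (\<Sum>\<^sub>\<infinity>z. a z * (norm (g z))\<^sup>2)) UNIV"
    using bounded_a_summable[of "\<lambda>z. (norm (g z))\<^sup>2" "M\<^sup>2"] bd2 by simp
  have "((\<lambda>z. a z * (norm (g z))\<^sup>2 + - (2 * m * (a z * norm (g z))) + m\<^sup>2 * a z) has_sum
      ((\<Sum>\<^sub>\<infinity>z. a z * (norm (g z))\<^sup>2) + - (2 * m * m) + m\<^sup>2 * 1)) UNIV"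
    by (intro has_sum_add has_sum_uminusI has_sum_cmult_right s1 s2 a_sum)
  also have "(\<lambda>z. a z * (norm (g z))\<^sup>2 + - (2 * m * (a z * norm (g z))) + m\<^sup>2 * a z) =
      (\<lambda>z. a z * (norm (g z) - m)\<^sup>2)"
    by (auto simp: power2_eq_square algebra_simps)
  finally have "0 \<le> (\<Sum>\<^sub>\<infinity>z. a z * (norm (g z))\<^sup>2) + - (2 * m * m) + m\<^sup>2 * 1"
    by (rule has_sum_nonneg) (simp add: a_nonneg)
  then have "m\<^sup>2 \<le> (\<Sum>\<^sub>\<infinity>z. a z * (norm (g z))\<^sup>2)"
    by (simp add: power2_eq_square)
  moreover have "norm (\<Sum>\<^sub>\<infinity>z. a z *\<^sub>R g z) \<le> m"
    by (rule norm_infsum_le[OF has_sum_infsum[OF bounded_a_summable[of g M, OF bd]] s1])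
       (simp add: a_nonneg)
  ultimately show ?thesis
    by (meson norm_ge_zero order_trans power_mono)
qed

text \<open>Jensen's inequality summed over a finite set of base points: the average over \<open>z\<close> of
  functions \<open>h _ z\<close> with square sums at most \<open>S z\<close> has square sum at most the average of
  \<open>S\<close>.\<close>

lemma sum_weighted_le:
  fixes h :: "'i \<Rightarrow> int ^ 'n \<Rightarrow> complex"
  assumes "finite F" "\<And>x z. norm (h x z) \<le> M"
    and "\<And>z. (\<Sum>x\<in>F. (norm (h x z))\<^sup>2) \<le> S z" "(\<lambda>z. a z * S z) summable_on UNIV"
  shows "(\<Sum>x\<in>F. (norm (\<Sum>\<^sub>\<infinity>z. a z *\<^sub>R h x z))\<^sup>2) \<le> (\<Sum>\<^sub>\<infinity>z. a z * S z)"
proof -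
  have bd2: "norm ((norm (h x z))\<^sup>2) \<le> M\<^sup>2" for x z
    using power_mono[OF assms(2)[of x z]] by simp
  have summ: "(\<lambda>z. a z * (norm (h x z))\<^sup>2) summable_on UNIV" for x
    using bounded_a_summable[of "\<lambda>z. (norm (h x z))\<^sup>2" "M\<^sup>2"] bd2 by simp
  have "(\<Sum>x\<in>F. (norm (\<Sum>\<^sub>\<infinity>z. a z *\<^sub>R h x z))\<^sup>2) \<le> (\<Sum>x\<in>F. \<Sum>\<^sub>\<infinity>z. a z * (norm (h x z))\<^sup>2)"
    by (intro sum_mono weighted_Jensen[where M=M] assms(2))
  also have "\<dots> \<le> (\<Sum>\<^sub>\<infinity>z. a z * S z)"
  proof (rule has_sum_mono)
    show "((\<lambda>z. \<Sum>x\<in>F. a z * (norm (h x z))\<^sup>2) has_sum (\<Sum>x\<in>F. \<Sum>\<^sub>\<infinity>z. a z * (norm (h x z))\<^sup>2)) UNIV"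
      using summ by (intro has_sum_finite_sum has_sum_infsum)
    show "((\<lambda>z. a z * S z) has_sum (\<Sum>\<^sub>\<infinity>z. a z * S z)) UNIV"
      using assms(4) by (rule has_sum_infsum)
    show "(\<Sum>x\<in>F. a z * (norm (h x z))\<^sup>2) \<le> a z * S z" for z
      using assms(3)[of z] a_nonneg[of z] by (simp add: sum_distrib_left[symmetric] mult_left_mono)
  qed
  finally show ?thesis .
qed

lemma avg_l2:
  assumes "f \<in> l2" "finite F"
  shows "(\<Sum>x\<in>F. (norm (avg f x))\<^sup>2) \<le> (l2_norm f)\<^sup>2"
proof -
  have s: "((\<lambda>z. a z * (l2_norm f)\<^sup>2) has_sum (l2_norm f)\<^sup>2) UNIV"
    using a_cmult_has_sum[of "(l2_norm f)\<^sup>2"] by simp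
  have "(\<Sum>x\<in>F. (norm (avg f x))\<^sup>2) \<le> (\<Sum>\<^sub>\<infinity>z. a z * (l2_norm f)\<^sup>2)"
    unfolding avg_def
    by (intro sum_weighted_le[where M="l2_norm f"] assms norm_le_l2_norm
        sum_shift_le_l2_norm has_sum_imp_summable[OF s])
  then show ?thesis using infsumI[OF s] by simp
qed

lemma avg_in_l2: "f \<in> l2 \<Longrightarrow> avg f \<in> l2"
  using l2I(1) avg_l2 by blast

end

section \<open>The resolvent of the walk\<close>

text \<open>Convexity of the square, for the weights \<open>q / (\<mu> + q)\<close> and \<open>\<mu> / (\<mu> + q)\<close> at the points
  \<open>p\<close> and \<open>r / \<mu>\<close>.\<close>

lemma convex_square:
  fixes p r :: complex
  assumes "\<mu> > 0" "q \<ge> 0"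
  shows "(norm ((of_real q * p + r) / of_real (\<mu> + q)))\<^sup>2
    \<le> (q * (norm p)\<^sup>2 + (norm r)\<^sup>2 / \<mu>) / (\<mu> + q)"
proof -
  define s t where "s = norm p" and "t = norm r / \<mu>"
  have "norm (of_real q * p + r) \<le> q * s + \<mu> * t"
    using norm_triangle_ineq[of "of_real q * p" r] assms by (simp add: s_def t_def norm_mult)
  then have "(norm (of_real q * p + r))\<^sup>2 \<le> (q * s + \<mu> * t)\<^sup>2" by (intro power_mono) auto
  also have "(\<mu> + q) * (q * s\<^sup>2 + \<mu> * t\<^sup>2) - (q * s + \<mu> * t)\<^sup>2 = \<mu> * q * (s - t)\<^sup>2"
    by (simp add: power2_eq_square algebra_simps)
  then have "(q * s + \<mu> * t)\<^sup>2 \<le> (\<mu> + q) * (q * s\<^sup>2 + \<mu> * t\<^sup>2)"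
    using assms by (smt (verit) mult_nonneg_nonneg zero_le_power2)
  finally have "(norm (of_real q * p + r))\<^sup>2 / (\<mu> + q)\<^sup>2 \<le> (\<mu> + q) * (q * s\<^sup>2 + \<mu> * t\<^sup>2) / (\<mu> + q)\<^sup>2"
    by (intro divide_right_mono) auto
  also have "\<dots> = (q * s\<^sup>2 + \<mu> * t\<^sup>2) / (\<mu> + q)"
    using assms by (simp add: power2_eq_square)
  also have "\<mu> * t\<^sup>2 = (norm r)\<^sup>2 / \<mu>"
    using assms by (simp add: t_def power2_eq_square)
  also have "(norm (of_real q * p + r))\<^sup>2 / (\<mu> + q)\<^sup>2 = (norm ((of_real q * p + r) / of_real (\<mu> + q)))\<^sup>2"
    using assms by (simp add: norm_divide power_divide del: of_real_add)
  finally show ?thesis by (simp add: s_def)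
qed

context walk_kernel
begin

text \<open>The equation \<open>(\<mu> - q walk_op a) f = g\<close> is used in the form
  \<open>(\<mu> + q) f = q avg f + g\<close>. Uniqueness holds among all bounded functions, so that a solution
  found by Fourier analysis is automatically the one in \<open>l2\<close>.\<close>

lemma resolvent_unique:
  fixes h :: "int ^ 'n \<Rightarrow> complex"
  assumes "\<mu> > 0" "q \<ge> 0" and bd: "\<And>x. norm (h x) \<le> M"
    and eq: "\<And>x. of_real (\<mu> + q) * h x = of_real q * avg h x"
  shows "h x = 0"
proof -
  define N where "N = (SUP x. norm (h x))"
  have bdd: "bdd_above (range (\<lambda>x. norm (h x)))" using bd by (intro bdd_aboveI[of _ M]) auto
  have le: "norm (h x) \<le> N" for x
    unfolding N_def using bdd by (intro cSUP_upper) auto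
  have "norm (h x) \<le> q * N / (\<mu> + q)" for x
  proof -
    have "(\<mu> + q) * norm (h x) = norm (of_real (\<mu> + q) * h x)"
      using assms(1,2) by (simp add: norm_mult del: of_real_add)
    also have "\<dots> = q * norm (avg h x)" using assms unfolding eq by (simp add: norm_mult)
    also have "\<dots> \<le> q * N" using assms by (intro mult_left_mono avg_bound le) auto
    finally show ?thesis using assms by (simp add: field_simps)
  qed
  then have "N \<le> q * N / (\<mu> + q)" unfolding N_def by (intro cSUP_least) auto
  then have "\<mu> * N \<le> 0" using assms by (simp add: field_simps)
  then have "N \<le> 0" using assms by (simp add: mult_le_0_iff)
  with le[of x] show ?thesis by (metis norm_le_zero_iff order_trans)
qed

lemma avg_uniform_limit:
  fixes F :: "nat \<Rightarrow> int ^ 'n \<Rightarrow> complex"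
  assumes lim: "uniform_limit UNIV F f sequentially" and bd: "\<And>n x. norm (F n x) \<le> M"
    and bdf: "\<And>x. norm (f x) \<le> M"
  shows "(\<lambda>n. avg (F n) x) \<longlonglongrightarrow> avg f x"
proof (rule tendstoI)
  fix e :: real assume "e > 0"
  from uniform_limitD[OF lim, of "e/2"] \<open>e > 0\<close>
  have "\<forall>\<^sub>F n in sequentially. \<forall>x. dist (F n x) (f x) < e/2" by simp
  then show "\<forall>\<^sub>F n in sequentially. dist (avg (F n) x) (avg f x) < e"
  proof eventually_elim
    case (elim n)
    have "dist (avg (F n) x) (avg f x) = norm (avg (\<lambda>z. 1 * F n z + (-1) * f z) x)"
      using avg_lincomb[where f="F n" and g=f and M=M and N=M and c=1 and d="-1" and x=x] bd bdf
      by (simp add: dist_norm)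
    also have "\<dots> \<le> e / 2"
      using elim by (intro avg_bound) (auto simp: dist_norm intro: less_imp_le)
    finally show ?case using \<open>e > 0\<close> by simp
  qed
qed

text \<open>The solution is the uniform limit of the iterates of
  \<open>f \<mapsto> (q avg f + g) / (\<mu> + q)\<close>, which contracts the supremum norm and, by convexity of the
  square, preserves the ball of radius \<open>l2_norm g / \<mu>\<close> in \<open>l2\<close>; no completeness of \<open>l2\<close> is
  needed.\<close>

lemma resolvent_exists:
  assumes "\<mu> > 0" "q \<ge> 0" "g \<in> l2"
  shows "\<exists>f\<in>l2. (\<forall>x. of_real (\<mu> + q) * f x = of_real q * avg f x + g x) \<and>
    l2_norm f \<le> l2_norm g / \<mu>"
proof -
  define F where "F = rec_nat (\<lambda>x. 0) (\<lambda>_ f x. (of_real q * avg f x + g x) / of_real (\<mu> + q))"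
  have F0: "F 0 = (\<lambda>x. 0)" by (simp add: F_def)
  have FS: "F (Suc n) = (\<lambda>x. (of_real q * avg (F n) x + g x) / of_real (\<mu> + q))" for n
    by (simp add: F_def)
  define K where "K = l2_norm g / \<mu>"
  have K0: "K \<ge> 0" using assms by (simp add: K_def)
  have sumbd: "\<forall>X. finite X \<longrightarrow> (\<Sum>x\<in>X. (norm (F n x))\<^sup>2) \<le> K\<^sup>2" for n
  proof (induction n)
    case 0
    show ?case by (simp add: F0)
  next
    case (Suc n)
    have Fl2: "F n \<in> l2" and Fn: "(l2_norm (F n))\<^sup>2 \<le> K\<^sup>2"
      using l2I[of "F n" "K\<^sup>2"] Suc.IH by auto
    show ?case
    proof (intro allI impI)
      fix X :: "(int ^ 'n) set" assume X: "finite X"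
      have "(\<Sum>x\<in>X. (norm (F (Suc n) x))\<^sup>2)
          \<le> (\<Sum>x\<in>X. (q * (norm (avg (F n) x))\<^sup>2 + (norm (g x))\<^sup>2 / \<mu>) / (\<mu> + q))"
        unfolding FS by (intro sum_mono convex_square assms)
      also have "\<dots> = (q * (\<Sum>x\<in>X. (norm (avg (F n) x))\<^sup>2) + (\<Sum>x\<in>X. (norm (g x))\<^sup>2) / \<mu>) / (\<mu> + q)"
        by (simp add: sum.distrib sum_distrib_left sum_divide_distrib add_divide_distrib)
      also have "\<dots> \<le> (q * K\<^sup>2 + (l2_norm g)\<^sup>2 / \<mu>) / (\<mu> + q)"
        using assms order_trans[OF avg_l2[OF Fl2 X] Fn] sum_le_l2_norm[OF assms(3) X]
        by (intro divide_right_mono add_mono mult_left_mono) auto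
      also have "(l2_norm g)\<^sup>2 / \<mu> = \<mu> * K\<^sup>2"
        using assms by (simp add: K_def power2_eq_square)
      also have "(q * K\<^sup>2 + \<mu> * K\<^sup>2) / (\<mu> + q) = K\<^sup>2"
        using assms by (simp add: field_simps)
      finally show "(\<Sum>x\<in>X. (norm (F (Suc n) x))\<^sup>2) \<le> K\<^sup>2" .
    qed
  qed
  have Fbd: "norm (F n x) \<le> K" for n x
    using spec[OF sumbd[of n], of "{x}"] K0 by (auto intro: power2_le_imp_le)
  define \<theta> where "\<theta> = q / (\<mu> + q)"
  have \<theta>: "0 \<le> \<theta>" "\<theta> < 1" using assms by (auto simp: \<theta>_def)
  have diff: "norm (F (Suc n) x - F n x) \<le> K * \<theta> ^ n" for n x
  proof (induction n arbitrary: x)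
    case 0
    show ?case using Fbd[of 1] by (simp add: F0)
  next
    case (Suc n)
    have av: "avg (\<lambda>z. F (Suc n) z - F n z) x = avg (F (Suc n)) x - avg (F n) x"
      using avg_lincomb[where f="F (Suc n)" and g="F n" and M=K and N=K and c=1 and d="-1" and x=x] Fbd
      by simp
    have "F (Suc (Suc n)) x - F (Suc n) x = of_real \<theta> * avg (\<lambda>z. F (Suc n) z - F n z) x"
    proof -
      have "F (Suc (Suc n)) x - F (Suc n) x =
          (of_real q * avg (F (Suc n)) x + g x) / of_real (\<mu> + q)
          - (of_real q * avg (F n) x + g x) / of_real (\<mu> + q)"
        using fun_cong[OF FS[of "Suc n"], of x] fun_cong[OF FS[of n], of x] by simp
      also have "\<dots> = of_real \<theta> * (avg (F (Suc n)) x - avg (F n) x)"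
        by (simp add: \<theta>_def diff_divide_distrib[symmetric] right_diff_distrib del: of_real_add)
      finally show ?thesis by (simp only: av)
    qed
    then have "norm (F (Suc (Suc n)) x - F (Suc n) x) = \<theta> * norm (avg (\<lambda>z. F (Suc n) z - F n z) x)"
      using \<theta> by (simp add: norm_mult)
    also have "\<dots> \<le> \<theta> * (K * \<theta> ^ n)"
      using \<theta> Suc.IH by (intro mult_left_mono avg_bound) auto
    finally show ?case by (simp add: mult_ac)
  qed
  define f where "f = (\<lambda>x. \<Sum>i. F (Suc i) x - F i x)"
  have "uniform_limit UNIV (\<lambda>n x. \<Sum>i<n. F (Suc i) x - F i x) f sequentially"
    unfolding f_def using diff \<theta>
    by (intro Weierstrass_m_test[where M="\<lambda>n. K * \<theta> ^ n"]) (auto intro!: summable_mult summable_geometric)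
  moreover have "(\<lambda>n x. \<Sum>i<n. F (Suc i) x - F i x) = F"
    using sum_lessThan_telescope[of "\<lambda>i. F i x" for x] by (simp add: fun_eq_iff F0)
  ultimately have lim: "uniform_limit UNIV F f sequentially" by simp
  then have ptw: "(\<lambda>n. F n x) \<longlonglongrightarrow> f x" for x
    by (rule tendsto_uniform_limitI) simp
  have fsum: "(\<Sum>x\<in>X. (norm (f x))\<^sup>2) \<le> K\<^sup>2" if "finite X" for X
    using that sumbd
    by (intro LIMSEQ_le_const2[of "\<lambda>n. (\<Sum>x\<in>X. (norm (F n x))\<^sup>2)"] tendsto_sum tendsto_power
        tendsto_norm ptw) auto
  have f_l2: "f \<in> l2" and fn: "(l2_norm f)\<^sup>2 \<le> K\<^sup>2" using l2I[OF fsum] by auto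
  have fn': "l2_norm f \<le> K" using fn K0 by (rule power2_le_imp_le)
  have fbd: "norm (f x) \<le> K" for x using norm_le_l2_norm[OF f_l2, of x] fn' by simp
  have "of_real (\<mu> + q) * f x = of_real q * avg f x + g x" for x
  proof -
    have "(\<lambda>n. F (Suc n) x) \<longlonglongrightarrow> (of_real q * avg f x + g x) / of_real (\<mu> + q)"
      unfolding FS using assms
      by (intro tendsto_intros avg_uniform_limit[OF lim Fbd fbd]) (auto simp del: of_real_add)
    moreover have "(\<lambda>n. F (Suc n) x) \<longlonglongrightarrow> f x" using ptw by (rule LIMSEQ_Suc)
    ultimately have "f x = (of_real q * avg f x + g x) / of_real (\<mu> + q)"
      using LIMSEQ_unique by blast
    then show ?thesis using assms
      by (metis add_pos_nonneg less_irrefl nonzero_mult_div_cancel_left of_real_eq_0_iff times_divide_eq_right)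
  qed
  with f_l2 fn' show ?thesis unfolding K_def by blast
qed

section \<open>The positive spectrum of the rank-one perturbation\<close>

lemma schroedinger_eq:
  assumes "f \<in> l2"
  shows "schroedinger_op \<kappa> a (indicator {0}) f x - of_real \<mu> * f x =
    of_real (2 * \<kappa>) * avg f x + of_real (- (\<mu> + 2 * \<kappa>)) * f x + f 0 * indicator {0} x"
proof -
  have "indicator {0} x *\<^sub>R f x = f 0 * indicator {0} x" by (auto simp: indicator_def)
  then show ?thesis
    unfolding schroedinger_op_def walk_op_eq[of f "l2_norm f", OF norm_le_l2_norm[OF assms]]
    by (simp add: scaleR_conv_of_real algebra_simps)
qed

lemma schroedinger_l2:
  assumes "f \<in> l2"
  shows "(\<lambda>x. schroedinger_op \<kappa> a (indicator {0}) f x - of_real \<mu> * f x) \<in> l2"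
proof -
  have "(\<lambda>x. of_real (2 * \<kappa>) * avg f x + of_real (- (\<mu> + 2 * \<kappa>)) * f x + f 0 * indicator {0} x) \<in> l2"
    by (intro l2_add(1) l2_cmult(1) avg_in_l2 assms indicator_l2) auto
  then show ?thesis by (simp only: schroedinger_eq[OF assms])
qed

text \<open>With \<open>R\<close> the resolvent of the walk and \<open>u = R \<delta>\<^sub>0\<close>, the equation
  \<open>(H - \<mu>) f = h\<close> reads \<open>f = f 0 u - R h\<close>; evaluated at the origin it determines \<open>f 0\<close>
  exactly when \<open>u 0 \<noteq> 1\<close>, and when \<open>u 0 = 1\<close> the function \<open>u\<close> is an eigenfunction.\<close>

lemma spectrum_iff:
  fixes u :: "int ^ 'n \<Rightarrow> complex"
  assumes "\<kappa> > 0" "\<mu> > 0" and bdu: "\<And>x. norm (u x) \<le> M"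
    and equ: "\<And>x. of_real (\<mu> + 2 * \<kappa>) * u x = of_real (2 * \<kappa>) * avg u x + indicator {0} x"
  shows "of_real \<mu> \<in> l2_spectrum (schroedinger_op \<kappa> a (indicator {0})) \<longleftrightarrow> u 0 = 1"
proof -
  define q where "q = 2 * \<kappa>"
  have q: "q > 0" using assms by (simp add: q_def)
  define L where "L = (\<lambda>f x. schroedinger_op \<kappa> a (indicator {0}) f x - of_real \<mu> * f x)"
  have L: "L f x = of_real q * avg f x + of_real (- (\<mu> + q)) * f x + f 0 * indicator {0} x"
    if "f \<in> l2" for f x
    unfolding L_def q_def using schroedinger_eq[OF that] by simp
  \<comment> \<open>The given bounded solution agrees with the square-summable one.\<close>
  have u_l2: "u \<in> l2"
  proof -
    obtain v where v: "v \<in> l2" 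
      "\<And>x. of_real (\<mu> + q) * v x = of_real q * avg v x + indicator {0} x"
      using resolvent_exists[of \<mu> q "indicator {0}"] assms indicator_l2(1)[of "{0}"] q by auto
    have "u x + (-1) * v x = 0" for x
    proof (rule resolvent_unique[of \<mu> q])
      show "norm (u x + (-1) * v x) \<le> M + l2_norm v" for x
        using norm_triangle_ineq4[of "u x" "v x"] bdu[of x] norm_le_l2_norm[OF v(1), of x] by simp
      have "avg (\<lambda>x. 1 * u x + (-1) * v x) x = 1 * avg u x + (-1) * avg v x" for x
        by (intro avg_lincomb[OF bdu norm_le_l2_norm[OF v(1)]])
      then have av: "avg (\<lambda>x. u x + (-1) * v x) x = avg u x - avg v x" for x
        by simp
      show "of_real (\<mu> + q) * (u x + (-1) * v x) = of_real q * avg (\<lambda>x. u x + (-1) * v x) x" for x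
        unfolding av using v(2)[of x] equ[of x] by (simp add: q_def algebra_simps)
    qed (use assms q in auto)
    then have "u = v" by auto
    with v show ?thesis by simp
  qed
  have spec: "of_real \<mu> \<in> l2_spectrum (schroedinger_op \<kappa> a (indicator {0})) \<longleftrightarrow>
    \<not> (bij_betw L l2 l2 \<and> (\<exists>C. \<forall>f\<in>l2. l2_norm f \<le> C * l2_norm (L f)))"
    by (simp add: l2_spectrum_def L_def)
  show ?thesis
  proof (cases "u 0 = 1")
    case True
    have zero: "(\<lambda>x :: int ^ 'n. 0) \<in> l2" using l2_cmult(1)[OF u_l2, of 0] by simp
    have "L u x = 0" for x
      using equ[of x] True by (simp add: L[OF u_l2] q_def algebra_simps)
    moreover have "L (\<lambda>x. 0) x = 0" for x
      using L[OF zero, of x] by (simp add: avg_def)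
    ultimately have "L u = L (\<lambda>x. 0)" by auto
    moreover have "u \<noteq> (\<lambda>x. 0)" using True by (metis zero_neq_one)
    ultimately have "\<not> inj_on L l2" using u_l2 zero by (meson inj_onD)
    then show ?thesis unfolding spec using True by (auto simp: bij_betw_def)
  next
    case False
    \<comment> \<open>The candidate for \<open>L\<^sup>-\<^sup>1 h\<close> in terms of \<open>r = R h\<close>, with the forced value at the origin
      inserted for the coefficient of \<open>u\<close>.\<close>
    define sol where "sol = (\<lambda>(r :: int ^ 'n \<Rightarrow> complex) x. - (r 0) / (1 - u 0) * u x + (-1) * r x)"
    define res where "res = (\<lambda>r h. r \<in> l2 \<and>
      (\<forall>x. of_real (\<mu> + q) * r x = of_real q * avg r x + h x) \<and> l2_norm r \<le> l2_norm h / \<mu>)"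
    have res_ex: "\<exists>r. res r h" if "h \<in> l2" for h
      using resolvent_exists[OF assms(2) _ that, of q] q unfolding res_def by auto
    have sol_l2: "sol r \<in> l2" if "r \<in> l2" for r
      unfolding sol_def by (intro l2_add(1) l2_cmult(1) u_l2 that)
    have L_sol: "L (sol r) = h" if "res r h" for r h
    proof
      fix x
      have r: "r \<in> l2" "of_real (\<mu> + q) * r x = of_real q * avg r x + h x"
        using that by (auto simp: res_def)
      define s where "s = - (r 0) / (1 - u 0)"
      have s0: "sol r 0 = s" using False by (simp add: sol_def s_def field_simps)
      have av: "avg (sol r) x = s * avg u x + (-1) * avg r x"
        unfolding sol_def s_def[symmetric] by (intro avg_lincomb[OF bdu norm_le_l2_norm[OF r(1)]])
      have sol_x: "sol r x = s * u x + (-1) * r x" by (simp add: sol_def s_def)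
      have "L (sol r) x = s * (of_real q * avg u x - of_real (\<mu> + q) * u x + indicator {0} x)
          - (of_real q * avg r x - of_real (\<mu> + q) * r x)"
        unfolding L[OF sol_l2[OF r(1)]] s0 av sol_x by (simp add: algebra_simps)
      also have "\<dots> = h x" using r(2) equ[of x] by (simp add: q_def algebra_simps)
      finally show "L (sol r) x = h x" .
    qed
    have sol_unique: "f = sol r" if "f \<in> l2" "res r (L f)" for f r
    proof -
      have r: "r \<in> l2" "\<And>x. of_real (\<mu> + q) * r x = of_real q * avg r x + L f x"
        using that by (auto simp: res_def)
      define g where "g = (\<lambda>x. 1 * f x + 1 * r x)"
      have g: "g \<in> l2" unfolding g_def by (intro l2_add(1) l2_cmult(1) that r)
      have w: "1 * g x + (- f 0) * u x = 0" for x
      proof (rule resolvent_unique[of \<mu> q])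
        show "norm (1 * g x + (- f 0) * u x) \<le> l2_norm g + norm (f 0) * M" for x
          using norm_triangle_ineq4[of "g x" "f 0 * u x"] norm_le_l2_norm[OF g, of x]
            mult_left_mono[OF bdu[of x], of "norm (f 0)"] by (simp add: norm_mult)
        have "avg (\<lambda>x. 1 * g x + (- f 0) * u x) x = 1 * avg g x + (- f 0) * avg u x" for x
          by (intro avg_lincomb[OF norm_le_l2_norm[OF g] bdu])
        moreover have "avg g x = 1 * avg f x + 1 * avg r x" for x
          unfolding g_def by (intro avg_lincomb[OF norm_le_l2_norm[OF that(1)] norm_le_l2_norm[OF r(1)]])
        ultimately have av: "avg (\<lambda>x. 1 * g x + (- f 0) * u x) x = avg f x + avg r x - f 0 * avg u x" for x
          by simp
        show "of_real (\<mu> + q) * (1 * g x + (- f 0) * u x)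
            = of_real q * avg (\<lambda>x. 1 * g x + (- f 0) * u x) x" for x
        proof -
          define m where "m = complex_of_real (\<mu> + q)"
          have "m * u x = of_real q * avg u x + indicator {0} x"
            using equ[of x] by (simp add: q_def m_def)
          moreover have "m * r x = of_real q * avg r x + L f x" unfolding m_def by (rule r(2))
          moreover have "L f x = of_real q * avg f x - m * f x + f 0 * indicator {0} x"
            unfolding L[OF that(1)] m_def by (simp add: algebra_simps)
          moreover have "m * (1 * g x + (- f 0) * u x) = m * f x + m * r x - f 0 * (m * u x)"
            by (simp add: g_def algebra_simps)
          ultimately have "m * (1 * g x + (- f 0) * u x)
              = of_real q * (avg f x + avg r x - f 0 * avg u x)"
            by (simp add: distrib_left right_diff_distrib mult.left_commute)
          then show ?thesis unfolding av m_def .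
        qed
      qed (use assms q in auto)
      have f: "f x = f 0 * u x - r x" for x
        using w[of x] by (simp add: g_def algebra_simps)
      have "f 0 * (1 - u 0) = - r 0" using f[of 0] by algebra
      then have f0: "f 0 = - r 0 / (1 - u 0)" using False
        by (metis nonzero_mult_div_cancel_right right_minus_eq)
      have "f x = sol r x" for x
        by (subst f[of x], subst f0) (simp add: sol_def)
      then show ?thesis by blast
    qed
    have "inj_on L l2"
    proof (rule inj_onI)
      fix f g assume fg: "f \<in> l2" "g \<in> l2" "L f = L g"
      have "L f \<in> l2" unfolding L_def by (rule schroedinger_l2[OF fg(1)])
      then obtain r where "res r (L f)" using res_ex by blast
      then show "f = g" using sol_unique fg by metis
    qed
    moreover have "L ` l2 = l2"
    proof
      show "L ` l2 \<subseteq> l2" unfolding L_def using schroedinger_l2 by auto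
      show "l2 \<subseteq> L ` l2"
      proof
        fix h :: "int ^ 'n \<Rightarrow> complex" assume "h \<in> l2"
        then obtain r where r: "res r h" using res_ex by blast
        then have "r \<in> l2" by (simp add: res_def)
        then show "h \<in> L ` l2" using L_sol[OF r] sol_l2 by (metis imageI)
      qed
    qed
    moreover have "\<exists>C. \<forall>f\<in>l2. l2_norm f \<le> C * l2_norm (L f)"
    proof (intro exI ballI)
      fix f :: "int ^ 'n \<Rightarrow> complex" assume f: "f \<in> l2"
      have "L f \<in> l2" unfolding L_def by (rule schroedinger_l2[OF f])
      then obtain r where r: "res r (L f)" using res_ex by blast
      then have r_l2: "r \<in> l2" and rn: "l2_norm r \<le> l2_norm (L f) / \<mu>" by (auto simp: res_def)
      define s where "s = - (r 0) / (1 - u 0)"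
      have "norm s \<le> l2_norm r / norm (1 - u 0)"
        using norm_le_l2_norm[OF r_l2, of 0] by (simp add: s_def norm_divide divide_right_mono)
      then have s: "(norm s)\<^sup>2 \<le> (l2_norm r / norm (1 - u 0))\<^sup>2" by (intro power_mono) auto
      have "(l2_norm f)\<^sup>2 \<le> 2 * (l2_norm (\<lambda>x. s * u x))\<^sup>2 + 2 * (l2_norm (\<lambda>x. (-1) * r x))\<^sup>2"
        unfolding sol_unique[OF f r] sol_def s_def by (intro l2_add l2_cmult u_l2 r_l2)
      also have "\<dots> \<le> 2 * ((norm s)\<^sup>2 * (l2_norm u)\<^sup>2) + 2 * ((norm (-1 :: complex))\<^sup>2 * (l2_norm r)\<^sup>2)"
        by (intro add_mono mult_left_mono l2_cmult u_l2 r_l2) auto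
      also have "\<dots> \<le> 2 * ((l2_norm r / norm (1 - u 0))\<^sup>2 * (l2_norm u)\<^sup>2) + 2 * (l2_norm r)\<^sup>2"
        using s by (simp add: mult_right_mono)
      also have "\<dots> = (l2_norm r)\<^sup>2 * (2 * (l2_norm u / norm (1 - u 0))\<^sup>2 + 2)"
        by (simp add: power_divide algebra_simps)
      also have "\<dots> \<le> (l2_norm (L f) / \<mu>)\<^sup>2 * (2 * (l2_norm u / norm (1 - u 0))\<^sup>2 + 2)"
        by (intro mult_right_mono power_mono rn) auto
      also have "\<dots> = (sqrt (2 * (l2_norm u / norm (1 - u 0))\<^sup>2 + 2) / \<mu> * l2_norm (L f))\<^sup>2"
        by (simp add: power_mult_distrib power_divide)
      finally show "l2_norm f \<le> sqrt (2 * (l2_norm u / norm (1 - u 0))\<^sup>2 + 2) / \<mu> * l2_norm (L f)"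
        by (rule power2_le_imp_le) (use assms in auto)
    qed
    ultimately show ?thesis unfolding spec using False by (auto simp: bij_betw_def)
  qed
qed

end

section \<open>Zero belongs to the spectrum\<close>

lemma card_vec_cube: "card {x :: 'a ^ 'n. \<forall>i. x $ i \<in> I} = card I ^ CARD('n)"
proof -
  have "bij_betw vec_lambda (PiE (UNIV :: 'n set) (\<lambda>_. I)) {x :: 'a ^ 'n. \<forall>i. x $ i \<in> I}"
    by (rule bij_betwI[where g=vec_nth]) (auto simp: PiE_def)
  then have "card {x :: 'a ^ 'n. \<forall>i. x $ i \<in> I} = card (PiE (UNIV :: 'n set) (\<lambda>_. I))"
    by (simp add: bij_betw_same_card)
  then show ?thesis by (simp add: card_PiE)
qed

lemma finite_vec_cube: "finite I \<Longrightarrow> finite {x :: 'a ^ 'n. \<forall>i. x $ i \<in> I}"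
proof -
  assume "finite I"
  have "bij_betw vec_lambda (PiE (UNIV :: 'n set) (\<lambda>_. I)) {x :: 'a ^ 'n. \<forall>i. x $ i \<in> I}"
    by (rule bij_betwI[where g=vec_nth]) (auto simp: PiE_def)
  moreover have "finite (PiE (UNIV :: 'n set) (\<lambda>_. I))" using \<open>finite I\<close> by (intro finite_PiE) auto
  ultimately show ?thesis using bij_betw_finite by blast
qed

text \<open>The positive cube of side \<open>N\<close>, which avoids the origin.\<close>

definition cube :: "nat \<Rightarrow> (int ^ 'n) set" where
  "cube N = {x. \<forall>i. x $ i \<in> {1..int N}}"

lemma card_cube: "card (cube N :: (int ^ 'n) set) = N ^ CARD('n)"
  unfolding cube_def card_vec_cube by simp

lemma finite_cube [simp]: "finite (cube N)"
  unfolding cube_def by (rule finite_vec_cube) simp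

lemma zero_not_in_cube: "0 \<notin> (cube N :: (int ^ 'n) set)"
  by (simp add: cube_def)

text \<open>The points of the cube at distance at least \<open>R\<close> from its boundary remain in it under the
  shift; Bernoulli's inequality bounds their proportion from below.\<close>

lemma cube_overlap:
  fixes z :: "int ^ 'n"
  assumes z: "\<And>i. \<bar>z $ i\<bar> \<le> int R" and N: "2 * R \<le> N" "N > 0"
  shows "real N ^ CARD('n) * (1 - 2 * real CARD('n) * R / N) \<le>
    real (card {x \<in> cube N. x + z \<in> cube N})"
proof -
  have sub: "{x. \<forall>i. x $ i \<in> {1 + int R..int N - int R}} \<subseteq> {x \<in> cube N. x + z \<in> cube N}"
  proof (safe)
    fix x :: "int ^ 'n" assume x: "\<forall>i. x $ i \<in> {1 + int R..int N - int R}"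
    have "x $ i \<in> {1..int N} \<and> (x + z) $ i \<in> {1..int N}" for i
      using x[rule_format, of i] z[of i] by (auto simp: abs_le_iff)
    then show "x \<in> cube N" "x + z \<in> cube N" by (auto simp: cube_def)
  qed
  have card: "card {1 + int R..int N - int R} = N - 2 * R" using N(1) by (simp; linarith)
  have "card {x :: int ^ 'n. \<forall>i. x $ i \<in> {1 + int R..int N - int R}} = (N - 2 * R) ^ CARD('n)"
    unfolding card_vec_cube by (simp only: card)
  moreover have "finite {x \<in> cube N :: (int ^ 'n) set. x + z \<in> cube N}" by simp
  ultimately have "(N - 2 * R) ^ CARD('n) \<le> card {x \<in> cube N. x + z \<in> cube N}"
    using card_mono[OF _ sub] by simp
  then have up: "real ((N - 2 * R) ^ CARD('n)) \<le> real (card {x \<in> cube N. x + z \<in> cube N})"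
    by (simp only: of_nat_le_iff)
  define c where "c = 2 * real R / N"
  have c: "c \<le> 1" and N_c: "real (N - 2 * R) = real N * (1 - c)"
    using N by (simp_all add: c_def of_nat_diff field_simps)
  have "1 + real CARD('n) * (- c) \<le> (1 + (- c)) ^ CARD('n)"
    using c by (intro Bernoulli_inequality) simp
  then have "real N ^ CARD('n) * (1 - real CARD('n) * c) \<le> real N ^ CARD('n) * (1 - c) ^ CARD('n)"
    by (intro mult_left_mono) auto
  also have "\<dots> = real ((N - 2 * R) ^ CARD('n))"
    unfolding of_nat_power N_c power_mult_distrib ..
  also note up
  also have "real CARD('n) * c = 2 * real CARD('n) * R / N" by (simp add: c_def)
  finally show ?thesis .
qed

text \<open>The left-hand side counts points of \<open>F\<close> in the symmetric difference of \<open>B\<close> and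
  \<open>B - z\<close>.\<close>

lemma sum_indicator_shift_diff:
  fixes B :: "(int ^ 'n) set"
  assumes "finite B" "finite F"
  shows "(\<Sum>x\<in>F. (cmod (indicator B (x + z) - indicator B x))\<^sup>2)
    \<le> 2 * real (card B) - 2 * real (card {x \<in> B. x + z \<in> B})"
proof -
  define G where "G = F \<union> B \<union> (\<lambda>x. x - z) ` B"
  have G: "finite G" using assms by (simp add: G_def)
  have "(\<Sum>x\<in>F. (cmod (indicator B (x + z) - indicator B x))\<^sup>2)
      \<le> (\<Sum>x\<in>G. (cmod (indicator B (x + z) - indicator B x))\<^sup>2)"
    by (intro sum_mono2) (auto simp: G_def assms)
  also have "\<dots> = (\<Sum>x\<in>G. of_bool (x + z \<in> B) + of_bool (x \<in> B) - 2 * of_bool (x \<in> B \<and> x + z \<in> B))"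
    by (intro sum.cong) (auto simp: indicator_def)
  also have "\<dots> = real (card {x \<in> G. x + z \<in> B}) + real (card {x \<in> G. x \<in> B})
      - 2 * real (card {x \<in> G. x \<in> B \<and> x + z \<in> B})"
    using G by (simp add: sum.distrib sum_subtractf sum_distrib_left[symmetric] Int_def)
  also have "{x \<in> G. x \<in> B} = B" by (auto simp: G_def)
  also have "{x \<in> G. x \<in> B \<and> x + z \<in> B} = {x \<in> B. x + z \<in> B}" by (auto simp: G_def)
  also have "{x \<in> G. x + z \<in> B} = (\<lambda>x. x - z) ` B"
    by (force simp: G_def)
  also have "card ((\<lambda>x. x - z) ` B) = card B" by (intro card_image) (auto simp: inj_on_def)
  finally show ?thesis by simp
qed

context walk_kernel
begin

text \<open>Indicators of large cubes are approximate eigenfunctions of the walk for the eigenvalue 0: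
  a shift by \<open>z\<close> moves only a small part of the cube, and all but finitely many \<open>z\<close> carry
  little mass.\<close>

lemma walk_op_cube_small:
  assumes "e > 0"
  shows "\<exists>N>0. \<forall>F. finite F \<longrightarrow>
    (\<Sum>x\<in>F. (cmod (walk_op a (indicator (cube N)) x))\<^sup>2) \<le> e * real N ^ CARD('n)"
proof -
  \<comment> \<open>Shifts outside \<open>Z\<close> carry mass below \<open>e / 4\<close> and cost at most twice the volume \<open>V\<close> of the
    cube; shifts inside \<open>Z\<close> cost at most \<open>V * e / 2\<close> once \<open>N\<close> is large.\<close>
  obtain Z where Z: "finite Z" and aZ: "sum a Z > 1 - e / 4"
  proof -
    have "\<exists>Z. finite Z \<and> Z \<subseteq> UNIV \<and> dist (sum a Z) 1 \<le> e / 8"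
      by (rule has_sum_finite_approximation) (use a_sum assms in auto)
    then obtain Z where "finite Z" "\<bar>sum a Z - 1\<bar> \<le> e / 8" by (auto simp: dist_real_def)
    moreover from this(2) have "sum a Z > 1 - e / 4" using assms by linarith
    ultimately show ?thesis using that by blast
  qed
  have "finite (\<Union>z\<in>Z. range (\<lambda>i. nat \<bar>z $ i\<bar>))" using Z by auto
  then obtain R where "\<forall>m\<in>(\<Union>z\<in>Z. range (\<lambda>i. nat \<bar>z $ i\<bar>)). m \<le> R"
    using finite_nat_set_iff_bounded_le by blast
  then have R: "\<bar>z $ i\<bar> \<le> int R" if "z \<in> Z" for z i
  proof -
    have "nat \<bar>z $ i\<bar> \<in> (\<Union>z\<in>Z. range (\<lambda>i. nat \<bar>z $ i\<bar>))" using that by blast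
    then have "nat \<bar>z $ i\<bar> \<le> R" using \<open>\<forall>m\<in>_. m \<le> R\<close> by blast
    then show ?thesis by linarith
  qed
  obtain N0 :: nat where N0: "8 * real CARD('n) * R / e < real N0" using reals_Archimedean2 by blast
  define N where "N = Suc (N0 + 2 * R)"
  have N: "2 * R \<le> N" "N > 0" "4 * real CARD('n) * R / N \<le> e / 2"
  proof -
    have "8 * real CARD('n) * R < e * real N0" using N0 assms by (simp add: field_simps)
    also have "\<dots> \<le> e * real N" using assms by (intro mult_left_mono) (auto simp: N_def)
    finally show "4 * real CARD('n) * R / N \<le> e / 2" by (simp add: N_def field_simps)
  qed (auto simp: N_def)
  define T where "T = (\<lambda>z. 2 + - (2 - e / 2) * indicator Z z)"
  define f where "f = (indicator (cube N) :: int ^ 'n \<Rightarrow> complex)"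
  define V where "V = real N ^ CARD('n)"
  have V: "V \<ge> 0" by (simp add: V_def)
  have aT: "((\<lambda>z. a z * (V * T z)) has_sum V * (2 * 1 + - (2 - e / 2) * sum a Z)) UNIV"
  proof -
    have "((\<lambda>z. a z * indicator Z z) has_sum sum a Z) UNIV"
      by (rule has_sum_finite_neutralI) (use Z in auto)
    then have "((\<lambda>z. V * (2 * a z + - (2 - e / 2) * (a z * indicator Z z)))
        has_sum V * (2 * 1 + - (2 - e / 2) * sum a Z)) UNIV"
      by (intro has_sum_cmult_right has_sum_add a_sum)
    then show ?thesis by (simp add: T_def algebra_simps)
  qed
  have fb: "norm (f z) \<le> 1" for z by (simp add: f_def indicator_def)
  have wk: "walk_op a f x = (\<Sum>\<^sub>\<infinity>z. a z *\<^sub>R (f (x + z) - f x))" for x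
    unfolding walk_op_def by (rule infsum_cong_neutral) auto
  have "(\<Sum>x\<in>F. (cmod (walk_op a f x))\<^sup>2) \<le> e * V" if F: "finite F" for F
  proof -
    have "(\<Sum>x\<in>F. (cmod (walk_op a f x))\<^sup>2) \<le> (\<Sum>\<^sub>\<infinity>z. a z * (V * T z))"
      unfolding wk
    proof (rule sum_weighted_le[OF F])
      show "norm (f (x + z) - f x) \<le> 2" for x z
        using norm_triangle_ineq4[of "f (x + z)" "f x"] fb[of x] fb[of "x + z"] by simp
      show "(\<Sum>x\<in>F. (cmod (f (x + z) - f x))\<^sup>2) \<le> V * T z" for z
      proof -
        have le: "(\<Sum>x\<in>F. (cmod (f (x + z) - f x))\<^sup>2)
            \<le> 2 * V - 2 * real (card {x \<in> cube N. x + z \<in> cube N})"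
          using sum_indicator_shift_diff[of "cube N :: (int ^ 'n) set" F z] F
          by (simp add: f_def V_def card_cube)
        show ?thesis
        proof (cases "z \<in> Z")
          case True
          have "V * (1 - 2 * real CARD('n) * R / N) \<le> real (card {x \<in> cube N. x + z \<in> cube N})"
            unfolding V_def using R[OF True] N by (intro cube_overlap) auto
          moreover have "V * (4 * real CARD('n) * R / N) = 2 * V - 2 * (V * (1 - 2 * real CARD('n) * R / N))"
            by (simp add: algebra_simps)
          ultimately have "(\<Sum>x\<in>F. (cmod (f (x + z) - f x))\<^sup>2) \<le> V * (4 * real CARD('n) * R / N)"
            using le by linarith
          also have "\<dots> \<le> V * (e / 2)" using N V by (intro mult_left_mono) auto
          finally show ?thesis using True by (simp add: T_def)
        next
          case False
          then show ?thesis using le by (simp add: T_def mult.commute)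
        qed
      qed
      show "(\<lambda>z. a z * (V * T z)) summable_on UNIV" using aT by (rule has_sum_imp_summable)
    qed
    also have "\<dots> = V * (2 * (1 - sum a Z) + e / 2 * sum a Z)"
      using infsumI[OF aT] by (simp add: algebra_simps)
    also have "\<dots> \<le> V * e"
    proof (intro mult_left_mono V)
      have "sum a Z \<le> 1" using finite_sum_le_has_sum[OF a_sum Z] a_nonneg by simp
      then have "e / 2 * sum a Z \<le> e / 2 * 1" using assms by (intro mult_left_mono) auto
      then show "2 * (1 - sum a Z) + e / 2 * sum a Z \<le> e" using aZ by simp
    qed
    finally show ?thesis by (simp add: mult.commute)
  qed
  then show ?thesis using N(2) unfolding f_def V_def by blast
qed

lemma zero_in_spectrum:
  "0 \<in> l2_spectrum (schroedinger_op \<kappa> a (indicator {0}))"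
proof (rule ccontr)
  assume "\<not> ?thesis"
  then obtain C where C: "\<And>f. f \<in> l2 \<Longrightarrow>
      l2_norm f \<le> C * l2_norm (\<lambda>x. schroedinger_op \<kappa> a (indicator {0}) f x - 0 * f x)"
    unfolding l2_spectrum_def by blast
  \<comment> \<open>A bound \<open>C\<close> on the inverse would give \<open>(l2_norm f)\<^sup>2 \<le> D * (l2_norm (walk_op a f))\<^sup>2\<close>; the
    summand 1 only ensures \<open>D > 0\<close>.\<close>
  define D where "D = C\<^sup>2 * (2 * \<kappa>)\<^sup>2 + 1"
  have D: "D > 0" by (simp add: D_def add_nonneg_pos)
  obtain N where N: "N > 0" and small: "\<And>F. finite F \<Longrightarrow>
      (\<Sum>x\<in>F. (cmod (walk_op a (indicator (cube N)) x))\<^sup>2) \<le> (1 / (2 * D)) * real N ^ CARD('n)"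
    using walk_op_cube_small[of "1 / (2 * D)"] D by auto
  define f where "f = (indicator (cube N) :: int ^ 'n \<Rightarrow> complex)"
  have f: "f \<in> l2" "(l2_norm f)\<^sup>2 = real N ^ CARD('n)"
    unfolding f_def using indicator_l2[of "cube N :: (int ^ 'n) set"] by (auto simp: card_cube)
  \<comment> \<open>The potential does not see \<open>f\<close>, which vanishes at the origin.\<close>
  have H: "schroedinger_op \<kappa> a (indicator {0}) f x - 0 * f x = of_real (2 * \<kappa>) * walk_op a f x" for x
    using zero_not_in_cube[of N]
    by (auto simp: schroedinger_op_def f_def indicator_def scaleR_conv_of_real)
  have w_l2: "walk_op a f \<in> l2" and wn: "(l2_norm (walk_op a f))\<^sup>2 \<le> (1 / (2 * D)) * real N ^ CARD('n)"
    using l2I[OF small] by (auto simp: f_def)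
  have "(l2_norm f)\<^sup>2 \<le> (C * l2_norm (\<lambda>x. of_real (2 * \<kappa>) * walk_op a f x))\<^sup>2"
    using C[OF f(1)] unfolding H by (intro power_mono) auto
  also have "\<dots> \<le> C\<^sup>2 * ((cmod (of_real (2 * \<kappa>)))\<^sup>2 * (l2_norm (walk_op a f))\<^sup>2)"
    unfolding power_mult_distrib by (intro mult_left_mono l2_cmult w_l2) auto
  also have "\<dots> = (D - 1) * (l2_norm (walk_op a f))\<^sup>2" by (simp add: D_def norm_mult power_mult_distrib)
  also have "\<dots> \<le> D * (l2_norm (walk_op a f))\<^sup>2" by (intro mult_right_mono) auto
  also have "\<dots> \<le> D * ((1 / (2 * D)) * real N ^ CARD('n))"
    using D wn by (intro mult_left_mono) auto
  also have "\<dots> = real N ^ CARD('n) / 2" using D by simp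
  finally show False using N f(2) by simp
qed

end

section \<open>Fourier analysis on the torus\<close>

text \<open>Lebesgue measure on the torus, normalized to total mass 1, so that Fourier coefficients
  carry no factor \<open>(2\<pi>)\<^sup>-\<^sup>d\<close>. The underlying space is all of \<open>real ^ 'n\<close>.\<close>

definition tor :: "(real ^ 'n) measure" where
  "tor = uniform_measure lborel torus"

lemma torus_sets [measurable]: "torus \<in> sets borel"
  by (simp add: torus_def)

lemma mem_torus:
  fixes k :: "real ^ 'n"
  shows "k \<in> torus \<longleftrightarrow> (\<forall>b\<in>Basis. k \<bullet> b \<in> {-pi..pi})"
proof -
  have "(\<chi> i. - pi) \<bullet> b = - pi" "(\<chi> i. pi) \<bullet> b = pi" if "b \<in> Basis" for b :: "real ^ 'n"
    using that by (auto simp: Basis_vec_def inner_axis)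
  then show ?thesis unfolding torus_def mem_box by simp
qed

lemma emeasure_torus:
  "emeasure lborel (torus :: (real ^ 'n) set) \<noteq> 0" "emeasure lborel (torus :: (real ^ 'n) set) \<noteq> \<infinity>"
proof -
  have "(\<Prod>b\<in>(Basis :: (real ^ 'n) set). ((\<chi> i. pi) - (\<chi> i. - pi)) \<bullet> b) > 0"
    by (intro prod_pos) (auto simp: Basis_vec_def inner_axis)
  then show "emeasure lborel (torus :: (real ^ 'n) set) \<noteq> 0"
    unfolding torus_def by (subst emeasure_lborel_cbox_eq) (auto simp: Basis_vec_def inner_axis)
  show "emeasure lborel (torus :: (real ^ 'n) set) \<noteq> \<infinity>"
    unfolding torus_def by (simp add: emeasure_lborel_cbox_eq)
qed

interpretation tor: prob_space tor
  unfolding tor_def by (rule prob_space_uniform_measure) (use emeasure_torus in auto)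

lemma sets_tor [simp, measurable_cong]: "sets tor = sets borel"
  by (simp add: tor_def)

lemma space_tor [simp]: "space tor = UNIV"
  by (simp add: tor_def)

lemma borel_measurable_tor [simp]: "borel_measurable tor = borel_measurable borel"
  by (rule measurable_cong_sets) auto

lemma nn_integral_tor:
  fixes f :: "real ^ 'n \<Rightarrow> ennreal"
  assumes "f \<in> borel_measurable borel"
  shows "(\<integral>\<^sup>+k. f k \<partial>tor) = (\<integral>\<^sup>+k\<in>torus. f k \<partial>lborel) / emeasure lborel (torus :: (real ^ 'n) set)"
  unfolding tor_def by (rule nn_integral_uniform_measure) (use assms in auto)

lemma integrable_tor:
  fixes f :: "real ^ 'n \<Rightarrow> 'b::{banach,second_countable_topology}"
  assumes "f \<in> borel_measurable borel" "\<And>k. norm (f k) \<le> M"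
  shows "integrable tor f"
  by (rule tor.integrable_const_bound[of _ M]) (use assms in auto)

lemma integral_tor_bound:
  fixes f :: "real ^ 'n \<Rightarrow> real"
  assumes "f \<in> borel_measurable borel" "\<And>k. norm (f k) \<le> M"
  shows "\<bar>integral\<^sup>L tor f\<bar> \<le> M"
proof -
  have i: "integrable tor f" by (rule integrable_tor[OF assms])
  have "integral\<^sup>L tor f \<le> M" using assms(2) by (intro tor.integral_le_const i) (auto simp: abs_le_iff)
  moreover have "-M \<le> f k" for k using assms(2)[of k] by (auto simp: abs_le_iff)
  then have "-M \<le> integral\<^sup>L tor f" by (intro tor.integral_ge_const i) auto
  ultimately show ?thesis by (simp add: abs_le_iff)
qed

lemma integral_cis_interval:
  assumes "n \<noteq> 0"
  shows "(\<integral>t. indicator {-pi..pi} t *\<^sub>R cis (t * real_of_int n) \<partial>lborel) = 0"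
proof -
  define F where "F = (\<lambda>t. (1 / (\<i> * of_int n)) * cis (t * real_of_int n))"
  have "(F has_vector_derivative cis (t * real_of_int n)) (at t within {-pi..pi})" for t
    unfolding F_def has_vector_derivative_def using assms
    by (auto intro!: derivative_eq_intros simp: scaleR_conv_of_real field_simps)
  then have "(\<integral>t. indicator {-pi..pi} t *\<^sub>R cis (t * real_of_int n) \<partial>lborel) = F pi - F (-pi)"
    by (intro integral_FTC_Icc continuous_intros) auto
  also have "F pi = F (-pi)"
  proof -
    \<comment> \<open>The antiderivative is periodic because \<open>n\<close> is an integer.\<close>
    have "cis (pi * real_of_int n) = cis (- pi * real_of_int n) * cis (2 * pi * real_of_int n)"
      by (simp add: cis_mult algebra_simps)
    also have "\<dots> = cis (- pi * real_of_int n)" by simp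
    finally show ?thesis by (simp add: F_def)
  qed
  finally show ?thesis by simp
qed

lemma lattice_vec_add: "lattice_vec (x + y) = lattice_vec x + lattice_vec y"
  by (simp add: lattice_vec_def vec_eq_iff)

lemma lattice_vec_minus: "lattice_vec (- x) = - lattice_vec x"
  by (simp add: lattice_vec_def vec_eq_iff)

lemma lattice_vec_0 [simp]: "lattice_vec 0 = 0"
  by (simp add: lattice_vec_def vec_eq_iff)

text \<open>Orthogonality of characters: the integral over the torus is a product of integrals over
  \<open>[-\<pi>, \<pi>]\<close>.\<close>

lemma integral_character:
  fixes x :: "int ^ 'n"
  shows "(\<integral>k. cos (k \<bullet> lattice_vec x) \<partial>tor) = indicator {0} x"
proof (cases "x = 0")
  case True
  then show ?thesis using tor.prob_space by simp
next
  case False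
  then obtain i where i: "x $ i \<noteq> 0" by (auto simp: vec_eq_iff)
  define v where "v = lattice_vec x"
  define c where "c = measure lborel (torus :: (real ^ 'n) set)"
  have ec: "emeasure lborel (torus :: (real ^ 'n) set) = ennreal c"
    unfolding c_def using emeasure_torus by (intro emeasure_eq_ennreal_measure) auto
  then have c: "c > 0" using emeasure_torus(1) by (metis c_def ennreal_0 measure_nonneg order_le_less)
  have tor_eq: "tor = density lborel (\<lambda>k :: real ^ 'n. ennreal (indicator torus k / c))"
    unfolding tor_def uniform_measure_def ec using c
    by (intro arg_cong2[where f=density] refl) (auto simp: indicator_def divide_ennreal simp flip: ennreal_1)
  define h where "h = (\<lambda>(b :: real ^ 'n) (t :: real). indicator {-pi..pi} t *\<^sub>R cis (t * (v \<bullet> b)))"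
  have h_int: "integrable lborel (h b)" for b
    unfolding h_def by (intro borel_integrable_compact continuous_intros) auto
  have [measurable]: "h b \<in> borel_measurable borel" for b
    using borel_measurable_integrable[OF h_int] by simp
  have h_prod_meas: "(\<lambda>k. \<Prod>b\<in>Basis. h b (k \<bullet> b)) \<in> borel_measurable borel"
    by measurable
  have h_prod: "indicator torus k *\<^sub>R cis (k \<bullet> v) = (\<Prod>b\<in>Basis. h b (k \<bullet> b))" for k :: "real ^ 'n"
  proof -
    have "indicator torus k = (\<Prod>b\<in>Basis. indicator {-pi..pi} (k \<bullet> b) :: real)"
    proof (cases "k \<in> torus")
      case True
      then have "(\<Prod>b\<in>Basis. indicator {-pi..pi} (k \<bullet> b) :: real) = 1"
        by (intro prod.neutral) (simp add: mem_torus)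
      then show ?thesis using True by simp
    next
      case False
      then have "(\<Prod>b\<in>Basis. indicator {-pi..pi} (k \<bullet> b) :: real) = 0"
        by (intro prod_zero) (auto simp: mem_torus indicator_def)
      then show ?thesis using False by simp
    qed
    moreover have "cis (k \<bullet> v) = (\<Prod>b\<in>Basis. cis ((k \<bullet> b) * (v \<bullet> b)))"
    proof -
      have "cis (\<Sum>b\<in>B. g b) = (\<Prod>b\<in>B. cis (g b))" if "finite B" for B and g :: "real ^ 'n \<Rightarrow> real"
        using that by (induction B rule: finite_induct) (auto simp flip: cis_mult)
      then show ?thesis by (subst euclidean_inner) auto
    qed
    ultimately show ?thesis
      by (simp add: h_def scaleR_conv_of_real prod.distrib)
  qed
  interpret P: product_sigma_finite "\<lambda>b :: real ^ 'n. lborel :: real measure"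
    by standard
  have "(\<integral>k. indicator torus k *\<^sub>R cis (k \<bullet> v) \<partial>lborel)
      = (\<integral>f. (\<Prod>b\<in>Basis. h b ((\<Sum>b\<in>Basis. f b *\<^sub>R b) \<bullet> b)) \<partial>(\<Pi>\<^sub>M b\<in>(Basis :: (real ^ 'n) set). lborel))"
    unfolding h_prod 
    by (subst lborel_eq, subst integral_distr) (use h_prod_meas in auto)
  also have "\<dots> = (\<integral>f. (\<Prod>b\<in>Basis. h b (f b)) \<partial>(\<Pi>\<^sub>M b\<in>(Basis :: (real ^ 'n) set). lborel))"
    by (intro Bochner_Integration.integral_cong refl prod.cong) (simp add: inner_sum_left_Basis)
  also have "\<dots> = (\<Prod>b\<in>Basis. integral\<^sup>L lborel (h b))"
    by (intro P.product_integral_prod h_int) auto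
  also have "\<dots> = 0"
  proof (rule prod_zero)
    have "v \<bullet> axis i 1 = real_of_int (x $ i)" by (simp add: v_def lattice_vec_def inner_axis)
    then have "integral\<^sup>L lborel (h (axis i 1)) = 0"
      unfolding h_def using integral_cis_interval[OF i] by simp
    then show "\<exists>b\<in>Basis. integral\<^sup>L lborel (h b) = 0" by (auto simp: Basis_vec_def)
  qed simp
  finally have zero: "(\<integral>k. indicator torus k *\<^sub>R cis (k \<bullet> v) \<partial>lborel) = 0" .
  have cis_int: "integrable tor (\<lambda>k. cis (k \<bullet> v))"
    by (rule integrable_tor[of _ 1]) (auto intro!: borel_measurable_continuous_onI continuous_intros)
  have "(\<integral>k. cis (k \<bullet> v) \<partial>tor) = (\<integral>k. (indicator torus k / c) *\<^sub>R cis (k \<bullet> v) \<partial>lborel)"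
    unfolding tor_eq using c
    by (intro integral_density) (auto intro!: borel_measurable_continuous_onI continuous_intros)
  also have "\<dots> = (\<integral>k. (1 / c) *\<^sub>R (indicator torus k *\<^sub>R cis (k \<bullet> v)) \<partial>lborel)" by simp
  also have "\<dots> = 0" by (subst integral_scaleR_right) (simp add: zero)
  finally have "Re (\<integral>k. cis (k \<bullet> v) \<partial>tor) = 0" by simp
  also have "Re (\<integral>k. cis (k \<bullet> v) \<partial>tor) = (\<integral>k. cos (k \<bullet> v) \<partial>tor)"
    using integral_Re[OF cis_int] by simp
  finally show ?thesis using False by (simp add: v_def)
qed

text \<open>Cosine Fourier coefficients with respect to the normalized measure. All functions \<open>F\<close> of
  interest depend on \<open>a_hat a\<close> only, hence are even and have no sine part.\<close>

definition ft :: "(real ^ 'n \<Rightarrow> real) \<Rightarrow> int ^ 'n \<Rightarrow> real" where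
  "ft F x = (\<integral>k. F k * cos (k \<bullet> lattice_vec x) \<partial>tor)"

lemma char_measurable [measurable]: "(\<lambda>k. cos (k \<bullet> lattice_vec x)) \<in> borel_measurable borel"
  by (auto intro!: borel_measurable_continuous_onI continuous_intros)

lemma mult_cos_bound: "\<bar>r\<bar> \<le> M \<Longrightarrow> \<bar>r * cos t\<bar> \<le> M" for r :: real
  using mult_mono[of "\<bar>r\<bar>" M "\<bar>cos t\<bar>" 1] by (simp add: abs_mult)

lemma ft_integrable:
  assumes "F \<in> borel_measurable borel" "\<And>k. \<bar>F k\<bar> \<le> M"
  shows "integrable tor (\<lambda>k. F k * cos (k \<bullet> lattice_vec x))"
  by (rule integrable_tor[of _ M]) (use assms mult_cos_bound in auto)

lemma ft_bound:
  assumes "F \<in> borel_measurable borel" "\<And>k. \<bar>F k\<bar> \<le> M"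
  shows "\<bar>ft F x\<bar> \<le> M"
  unfolding ft_def by (rule integral_tor_bound) (use assms mult_cos_bound in auto)

lemma ft_one: "ft (\<lambda>k. 1) x = indicator {0} x"
  by (simp add: ft_def integral_character)

lemma ft_lincomb:
  assumes "F \<in> borel_measurable borel" "\<And>k. \<bar>F k\<bar> \<le> M"
    "G \<in> borel_measurable borel" "\<And>k. \<bar>G k\<bar> \<le> N"
  shows "ft (\<lambda>k. c * F k + d * G k) x = c * ft F x + d * ft G x"
proof -
  have "ft (\<lambda>k. c * F k + d * G k) x =
      (\<integral>k. c * (F k * cos (k \<bullet> lattice_vec x)) + d * (G k * cos (k \<bullet> lattice_vec x)) \<partial>tor)"
    by (simp add: ft_def algebra_simps)
  also have "\<dots> = c * ft F x + d * ft G x"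
    unfolding ft_def using ft_integrable[OF assms(1,2)] ft_integrable[OF assms(3,4)]
    by (subst Bochner_Integration.integral_add) auto
  finally show ?thesis .
qed

context walk_kernel
begin

text \<open>The terms for \<open>z\<close> and \<open>- z\<close> cancel.\<close>

lemma a_sin_zero: "((\<lambda>z. a z * sin (k \<bullet> lattice_vec z)) has_sum 0) UNIV"
proof -
  have "(\<lambda>z. a z * sin (k \<bullet> lattice_vec z)) summable_on UNIV"
    using bounded_a_summable[of "\<lambda>z. sin (k \<bullet> lattice_vec z)" 1] by simp
  then obtain S where S: "((\<lambda>z. a z * sin (k \<bullet> lattice_vec z)) has_sum S) UNIV"
    by (auto simp: summable_on_def)
  have "((\<lambda>z. a (- z) * sin (k \<bullet> lattice_vec (- z))) has_sum S) UNIV"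
    using S by (subst (asm) has_sum_reindex_bij_betw[of uminus UNIV UNIV, symmetric])
      (auto intro: bij_uminus)
  then have "((\<lambda>z. - (a z * sin (k \<bullet> lattice_vec z))) has_sum S) UNIV"
    by (simp add: a_sym lattice_vec_minus)
  then have "((\<lambda>z. a z * sin (k \<bullet> lattice_vec z)) has_sum - S) UNIV" by (simp add: has_sum_uminus)
  then have "S = - S" using S has_sum_unique by blast
  then show ?thesis using S by simp
qed

lemma a_cos_has_sum: "((\<lambda>z. a z * cos (k \<bullet> lattice_vec z)) has_sum a_hat a k) UNIV"
  unfolding a_hat_def using bounded_a_summable[of "\<lambda>z. cos (k \<bullet> lattice_vec z)" 1] by simp

lemma a_cos_shift_has_sum:
  "((\<lambda>z. a z * cos (k \<bullet> lattice_vec (x + z))) has_sum a_hat a k * cos (k \<bullet> lattice_vec x)) UNIV"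
proof -
  have "((\<lambda>z. cos (k \<bullet> lattice_vec x) * (a z * cos (k \<bullet> lattice_vec z))
      + - (sin (k \<bullet> lattice_vec x)) * (a z * sin (k \<bullet> lattice_vec z)))
      has_sum cos (k \<bullet> lattice_vec x) * a_hat a k + - (sin (k \<bullet> lattice_vec x)) * 0) UNIV"
    by (intro has_sum_add has_sum_cmult_right a_cos_has_sum a_sin_zero)
  then show ?thesis by (simp add: lattice_vec_add inner_add_right cos_add algebra_simps)
qed

lemma a_hat_abs_le: "\<bar>a_hat a k\<bar> \<le> 1"
proof -
  have "norm (a_hat a k) \<le> 1"
    by (rule norm_infsum_le[OF a_cos_has_sum a_sum])
      (auto simp: abs_mult a_nonneg mult_left_le)
  then show ?thesis by simp
qed

lemma a_cos_uniform_limit: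
  "uniform_limit UNIV (\<lambda>Z k. \<Sum>z\<in>Z. a z * cos (k \<bullet> lattice_vec (x + z)))
    (\<lambda>k. a_hat a k * cos (k \<bullet> lattice_vec x)) (finite_subsets_at_top UNIV)"
  by (rule Weierstrass_m_test_general'[where M=a])
    (auto simp: abs_mult a_nonneg mult_left_le a_cos_shift_has_sum a_summable)

lemma a_hat_measurable [measurable]: "a_hat a \<in> borel_measurable borel"
proof -
  have "continuous_on UNIV (\<lambda>k. a_hat a k * cos (k \<bullet> lattice_vec 0))"
    by (rule uniform_limit_theorem[OF _ a_cos_uniform_limit])
      (auto intro!: always_eventually continuous_intros)
  then show ?thesis by (intro borel_measurable_continuous_onI) simp
qed

text \<open>The walk acts on Fourier coefficients as multiplication by \<open>a_hat a\<close>. The sum over \<open>z\<close>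
  and the integral are exchanged by means of the uniform convergence of the cosine series.\<close>

lemma avg_ft:
  assumes F: "F \<in> borel_measurable borel" and M: "\<And>k. \<bar>F k\<bar> \<le> M"
  shows "avg (ft F) x = ft (\<lambda>k. a_hat a k * F k) x"
proof -
  define S where "S = (\<lambda>Z k. \<Sum>z\<in>Z. a z * cos (k \<bullet> lattice_vec (x + z)))"
  define T where "T = (\<lambda>k. a_hat a k * cos (k \<bullet> lattice_vec x))"
  have [measurable]: "F \<in> borel_measurable borel" by fact
  have [measurable]: "S Z \<in> borel_measurable borel" "T \<in> borel_measurable borel" for Z
    by (auto simp: S_def T_def)
  have M0: "M \<ge> 0" using M[of 0] by simp
  have T_int: "integrable tor (\<lambda>k. F k * T k)"
  proof (rule integrable_tor[of _ "M * 1"])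
    show "norm (F k * T k) \<le> M * 1" for k
      unfolding real_norm_def abs_mult T_def
      using M M0 mult_cos_bound[OF a_hat_abs_le] by (intro mult_mono) (auto simp: abs_mult)
  qed simp
  have S_eq: "(\<Sum>z\<in>Z. a z *\<^sub>R ft F (x + z)) = (\<integral>k. F k * S Z k \<partial>tor)"
    and S_int: "integrable tor (\<lambda>k. F k * S Z k)" for Z
  proof -
    have *: "F k * S Z k = (\<Sum>z\<in>Z. a z * (F k * cos (k \<bullet> lattice_vec (x + z))))" for k
      by (simp add: S_def sum_distrib_left mult_ac)
    show "integrable tor (\<lambda>k. F k * S Z k)"
      unfolding * using ft_integrable[OF assms]
      by (intro Bochner_Integration.integrable_sum integrable_mult_right) auto
    show "(\<Sum>z\<in>Z. a z *\<^sub>R ft F (x + z)) = (\<integral>k. F k * S Z k \<partial>tor)"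
      unfolding * using ft_integrable[OF assms]
      by (subst Bochner_Integration.integral_sum) (auto simp: ft_def)
  qed
  have "((\<lambda>z. a z *\<^sub>R ft F (x + z)) has_sum (\<integral>k. F k * T k \<partial>tor)) UNIV"
    unfolding has_sum_def
  proof (rule tendstoI)
    fix e :: real assume e: "e > 0"
    define d where "d = e / (M + 1)"
    have d: "d > 0" "M * d < e"
      using e M0 by (auto simp: d_def field_simps)
    have "\<forall>\<^sub>F Z in finite_subsets_at_top UNIV. \<forall>k\<in>UNIV. dist (S Z k) (T k) < d"
      using uniform_limitD[OF a_cos_uniform_limit d(1), of x] by (simp add: S_def T_def)
    then show "\<forall>\<^sub>F Z in finite_subsets_at_top UNIV.
        dist (\<Sum>z\<in>Z. a z *\<^sub>R ft F (x + z)) (\<integral>k. F k * T k \<partial>tor) < e"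
    proof eventually_elim
      case (elim Z)
      have "dist (\<Sum>z\<in>Z. a z *\<^sub>R ft F (x + z)) (\<integral>k. F k * T k \<partial>tor)
          = \<bar>\<integral>k. F k * (S Z k - T k) \<partial>tor\<bar>"
        unfolding S_eq dist_real_def right_diff_distrib
        by (subst Bochner_Integration.integral_diff[OF S_int T_int]) simp
      also have "\<dots> \<le> M * d"
      proof (rule integral_tor_bound)
        show "norm (F k * (S Z k - T k)) \<le> M * d" for k
          unfolding real_norm_def abs_mult
          using M M0 elim by (intro mult_mono) (auto simp: dist_real_def less_imp_le)
      qed measurable
      finally show ?case using d(2) by simp
    qed
  qed
  then have "avg (ft F) x = (\<integral>k. F k * T k \<partial>tor)" unfolding avg_def by (rule infsumI)
  then show ?thesis by (simp add: ft_def T_def mult_ac)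
qed

section \<open>The Green function\<close>

text \<open>The symbol \<open>1 - a_hat a\<close> of the operator \<open>- walk_op a\<close>.\<close>

definition symb :: "real ^ 'n \<Rightarrow> real" where
  "symb k = 1 - a_hat a k"

lemma symb_bounds: "0 \<le> symb k" "symb k \<le> 2"
  using a_hat_abs_le[of k] by (auto simp: symb_def abs_le_iff)

lemma symb_measurable [measurable]: "symb \<in> borel_measurable borel"
  unfolding symb_def by measurable

text \<open>The value at the origin of the resolvent \<open>(\<mu> - q walk_op a)\<^sup>-\<^sup>1\<close> applied to the indicator
  of the origin.\<close>

definition green :: "real \<Rightarrow> real \<Rightarrow> real" where
  "green q \<mu> = (\<integral>k. 1 / (\<mu> + q * symb k) \<partial>tor)"

lemma denominator_bounds:
  assumes "q > 0" "\<mu> > 0"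
  shows "\<mu> \<le> \<mu> + q * symb k" "\<mu> + q * symb k \<le> \<mu> + q * 2" "0 < \<mu> + q * symb k"
    "\<bar>1 / (\<mu> + q * symb k)\<bar> \<le> 1 / \<mu>"
proof -
  show *: "\<mu> \<le> \<mu> + q * symb k" "\<mu> + q * symb k \<le> \<mu> + q * 2"
    using symb_bounds[of k] assms by auto
  then show "0 < \<mu> + q * symb k" using assms by linarith
  show "\<bar>1 / (\<mu> + q * symb k)\<bar> \<le> 1 / \<mu>" using * assms by (auto intro!: divide_left_mono)
qed

lemma green_integrable: "q > 0 \<Longrightarrow> \<mu> > 0 \<Longrightarrow> integrable tor (\<lambda>k. 1 / (\<mu> + q * symb k))"
  by (rule integrable_tor[of _ "1 / \<mu>"]) (use denominator_bounds(4) in auto)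

text \<open>The resolvent equation becomes \<open>(\<mu> + q symb) F = 1\<close> for the Fourier transform \<open>F\<close> of its
  solution.\<close>

lemma green_solution:
  assumes "q > 0" "\<mu> > 0"
  defines "u \<equiv> ft (\<lambda>k. 1 / (\<mu> + q * symb k))"
  shows "\<bar>u x\<bar> \<le> 1 / \<mu>" "(\<mu> + q) * u x = q * avg u x + indicator {0} x" "u 0 = green q \<mu>"
proof -
  define F where "F = (\<lambda>k. 1 / (\<mu> + q * symb k))"
  have F: "F \<in> borel_measurable borel" unfolding F_def by measurable
  have Fb: "\<bar>F k\<bar> \<le> 1 / \<mu>" for k unfolding F_def by (rule denominator_bounds(4)[OF assms(1,2)])
  have aF: "(\<lambda>k. a_hat a k * F k) \<in> borel_measurable borel" using F by measurable
  have aFb: "\<bar>a_hat a k * F k\<bar> \<le> 1 / \<mu>" for k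
    using mult_mono[OF a_hat_abs_le[of k] Fb[of k]] by (simp add: abs_mult)
  show "\<bar>u x\<bar> \<le> 1 / \<mu>" unfolding u_def F_def[symmetric] by (rule ft_bound[OF F Fb])
  have "(\<lambda>k. (\<mu> + q) * F k + (- q) * (a_hat a k * F k)) = (\<lambda>k. 1)"
  proof
    fix k
    have "(\<mu> + q) * F k + (- q) * (a_hat a k * F k) = (\<mu> + q * symb k) * F k"
      by (simp add: symb_def algebra_simps)
    also have "\<dots> = 1" using denominator_bounds(3)[OF assms(1,2), of k] by (simp add: F_def)
    finally show "(\<mu> + q) * F k + (- q) * (a_hat a k * F k) = 1" .
  qed
  then have "(\<mu> + q) * ft F x + (- q) * ft (\<lambda>k. a_hat a k * F k) x = indicator {0} x"
    using ft_lincomb[OF F Fb aF aFb, of "\<mu> + q" "- q" x] by (simp add: ft_one)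
  then show "(\<mu> + q) * u x = q * avg u x + indicator {0} x"
    unfolding u_def F_def[symmetric] avg_ft[OF F Fb] by simp
  show "u 0 = green q \<mu>" by (simp add: u_def ft_def green_def)
qed

lemma green_strict_antimono:
  assumes "q > 0" "0 < \<mu>" "\<mu> < \<nu>"
  shows "green q \<nu> < green q \<mu>"
proof -
  define e where "e = (\<nu> - \<mu>) / ((\<mu> + q * 2) * (\<nu> + q * 2))"
  have e: "e > 0" using assms by (auto simp: e_def intro!: divide_pos_pos mult_pos_pos)
  have le: "e \<le> 1 / (\<mu> + q * symb k) - 1 / (\<nu> + q * symb k)" for k
  proof -
    have \<nu>: "\<nu> > 0" using assms by simp
    note b = denominator_bounds[OF assms(1,2), of k] denominator_bounds[OF assms(1) \<nu>, of k]
    have "1 / (\<mu> + q * symb k) - 1 / (\<nu> + q * symb k)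
        = (\<nu> - \<mu>) / ((\<mu> + q * symb k) * (\<nu> + q * symb k))"
      using b by (subst diff_frac_eq) auto
    moreover have "e \<le> (\<nu> - \<mu>) / ((\<mu> + q * symb k) * (\<nu> + q * symb k))"
      unfolding e_def using b assms by (intro divide_left_mono mult_mono mult_pos_pos) auto
    ultimately show ?thesis by simp
  qed
  have i: "integrable tor (\<lambda>k. 1 / (\<mu> + q * symb k))" "integrable tor (\<lambda>k. 1 / (\<nu> + q * symb k))"
    using assms by (auto intro!: green_integrable)
  have "e \<le> (\<integral>k. 1 / (\<mu> + q * symb k) - 1 / (\<nu> + q * symb k) \<partial>tor)"
    using le by (intro tor.integral_ge_const Bochner_Integration.integrable_diff i) auto
  also have "\<dots> = green q \<mu> - green q \<nu>"
    unfolding green_def by (rule Bochner_Integration.integral_diff[OF i])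
  finally show ?thesis using e by simp
qed

lemma green_le: "q > 0 \<Longrightarrow> \<mu> > 0 \<Longrightarrow> green q \<mu> \<le> 1 / \<mu>"
  unfolding green_def
  by (intro tor.integral_le_const green_integrable AE_I2 order_trans[OF abs_ge_self denominator_bounds(4)])

lemma green_continuous:
  assumes "q > 0" "\<mu>0 > 0"
  shows "continuous_on {\<mu>0..} (green q)"
proof -
  have one: "\<bar>green q \<mu> - green q \<nu>\<bar> \<le> \<bar>\<mu> - \<nu>\<bar> / (\<mu>0 * \<mu>0)" if "\<mu>0 \<le> \<mu>" "\<mu>0 \<le> \<nu>" for \<mu> \<nu>
  proof -
    have p: "\<mu> > 0" "\<nu> > 0" using that assms by auto
    have "\<bar>\<integral>k. 1 / (\<mu> + q * symb k) - 1 / (\<nu> + q * symb k) \<partial>tor\<bar> \<le> \<bar>\<mu> - \<nu>\<bar> / (\<mu>0 * \<mu>0)"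
    proof (rule integral_tor_bound)
      fix k
      note b = denominator_bounds[OF assms(1) p(1), of k] denominator_bounds[OF assms(1) p(2), of k]
      have "1 / (\<mu> + q * symb k) - 1 / (\<nu> + q * symb k)
          = (\<nu> - \<mu>) / ((\<mu> + q * symb k) * (\<nu> + q * symb k))"
        using b by (subst diff_frac_eq) auto
      then have "\<bar>1 / (\<mu> + q * symb k) - 1 / (\<nu> + q * symb k)\<bar>
          = \<bar>\<mu> - \<nu>\<bar> / ((\<mu> + q * symb k) * (\<nu> + q * symb k))"
        using b by (simp add: abs_mult)
      also have "\<dots> \<le> \<bar>\<mu> - \<nu>\<bar> / (\<mu>0 * \<mu>0)"
        using b that assms by (intro divide_left_mono mult_mono mult_pos_pos) auto
      finally show "norm (1 / (\<mu> + q * symb k) - 1 / (\<nu> + q * symb k)) \<le> \<bar>\<mu> - \<nu>\<bar> / (\<mu>0 * \<mu>0)"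
        by simp
    qed measurable
    then show ?thesis
      unfolding green_def
      by (subst (asm) Bochner_Integration.integral_diff) (use assms p in \<open>auto intro!: green_integrable\<close>)
  qed
  have "(1 / (\<mu>0 * \<mu>0))-lipschitz_on {\<mu>0..} (green q)"
    using one assms by (intro lipschitz_onI) (auto simp: dist_real_def)
  then show ?thesis by (rule lipschitz_on_continuous_on)
qed

section \<open>The torus integral\<close>

text \<open>The torus integral with respect to the normalized measure.\<close>

definition torus_mean :: ennreal where
  "torus_mean = (\<integral>\<^sup>+k. 1 / ennreal (symb k) \<partial>tor)"

lemma torus_mean_finite_iff: "torus_mean < \<infinity> \<longleftrightarrow> torus_integral a < \<infinity>"
proof -
  have "torus_mean = torus_integral a / emeasure lborel (torus :: (real ^ 'n) set)"
    unfolding torus_mean_def torus_integral_def symb_def[symmetric] by (rule nn_integral_tor) measurable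
  then have "torus_mean = top \<longleftrightarrow> torus_integral a = top"
    using emeasure_torus by (auto simp: ennreal_divide_eq_top_iff)
  then show ?thesis by (simp flip: less_top)
qed

lemma nn_integral_scaled_symb:
  assumes "q > 0"
  shows "(\<integral>\<^sup>+k. 1 / ennreal (q * symb k) \<partial>tor) = ennreal (1 / q) * torus_mean"
proof -
  have "1 / ennreal (q * symb k) = ennreal (1 / q) * (1 / ennreal (symb k))" for k
  proof (cases "symb k = 0")
    case True
    then show ?thesis using assms by (simp add: ennreal_mult_top)
  next
    case False
    then have "symb k > 0" using symb_bounds[of k] by simp
    then show ?thesis using assms
      by (simp add: divide_ennreal ennreal_mult[symmetric] flip: ennreal_1)
  qed
  then show ?thesis
    unfolding torus_mean_def by (simp add: nn_integral_cmult)
qed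

lemma green_le_torus_mean:
  assumes "q > 0" "\<mu> > 0"
  shows "ennreal (green q \<mu>) \<le> ennreal (1 / q) * torus_mean"
proof -
  have "ennreal (green q \<mu>) = (\<integral>\<^sup>+k. ennreal (1 / (\<mu> + q * symb k)) \<partial>tor)"
    unfolding green_def using denominator_bounds(3)[OF assms]
    by (intro nn_integral_eq_integral[symmetric] green_integrable assms) (auto simp: less_imp_le)
  also have "\<dots> \<le> (\<integral>\<^sup>+k. 1 / ennreal (q * symb k) \<partial>tor)"
  proof (rule nn_integral_mono)
    fix k
    show "ennreal (1 / (\<mu> + q * symb k)) \<le> 1 / ennreal (q * symb k)"
    proof (cases "symb k = 0")
      case False
      then have "symb k > 0" using symb_bounds[of k] by simp
      then have "1 / ennreal (q * symb k) = ennreal (1 / (q * symb k))"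
        using assms by (simp add: divide_ennreal flip: ennreal_1)
      then show ?thesis using assms \<open>symb k > 0\<close>
        by (auto intro!: ennreal_leI divide_left_mono mult_pos_pos add_pos_pos)
    qed simp
  qed
  finally show ?thesis by (simp add: nn_integral_scaled_symb[OF assms(1)])
qed

text \<open>Monotone convergence as \<open>\<mu>\<close> decreases to 0. The limit is taken in \<open>ennreal\<close>, so points where
  \<open>symb\<close> vanishes need no separate treatment.\<close>

lemma green_tendsto_torus_mean:
  assumes "q > 0"
  shows "(\<lambda>n. ennreal (green q (1 / real (Suc n)))) \<longlonglongrightarrow> ennreal (1 / q) * torus_mean"
proof -
  have eq: "ennreal (green q (1 / real (Suc n))) = (\<integral>\<^sup>+k. ennreal (1 / (1 / real (Suc n) + q * symb k)) \<partial>tor)" for n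
    unfolding green_def using denominator_bounds(3)[OF assms, of "1 / real (Suc n)"]
    by (intro nn_integral_eq_integral[symmetric] green_integrable assms) (auto simp: less_imp_le)
  have "(\<lambda>n. (\<integral>\<^sup>+k. ennreal (1 / (1 / real (Suc n) + q * symb k)) \<partial>tor))
      \<longlonglongrightarrow> (\<integral>\<^sup>+k. 1 / ennreal (q * symb k) \<partial>tor)"
  proof (rule nn_integral_LIMSEQ)
    show "incseq (\<lambda>n k. ennreal (1 / (1 / real (Suc n) + q * symb k)))"
    proof (intro incseq_SucI le_funI ennreal_leI)
      fix n k
      have "1 / real (Suc (Suc n)) \<le> 1 / real (Suc n)" by (simp add: field_simps)
      then show "1 / (1 / real (Suc n) + q * symb k) \<le> 1 / (1 / real (Suc (Suc n)) + q * symb k)"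
        using denominator_bounds(3)[OF assms, of "1 / real (Suc n)" k]
          denominator_bounds(3)[OF assms, of "1 / real (Suc (Suc n))" k]
        by (intro divide_left_mono mult_pos_pos) auto
    qed
    show "(\<lambda>n. ennreal (1 / (1 / real (Suc n) + q * symb k))) \<longlonglongrightarrow> 1 / ennreal (q * symb k)" for k
    proof -
      have "(\<lambda>n. 1 / real (Suc n) + q * symb k) \<longlonglongrightarrow> 0 + q * symb k"
        by (intro tendsto_intros LIMSEQ_Suc[OF lim_1_over_n])
      then have "(\<lambda>n. ennreal (1 / real (Suc n) + q * symb k)) \<longlonglongrightarrow> ennreal (q * symb k)"
        by (intro tendsto_ennrealI) simp
      then have "(\<lambda>n. inverse (ennreal (1 / real (Suc n) + q * symb k))) \<longlonglongrightarrow> inverse (ennreal (q * symb k))"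
        using continuous_on_tendsto_compose[OF continuous_on_inverse_ennreal[OF continuous_on_id[of UNIV]]]
        by simp
      moreover have "inverse (ennreal (1 / real (Suc n) + q * symb k)) = ennreal (1 / (1 / real (Suc n) + q * symb k))" for n
        using denominator_bounds(3)[OF assms, of "1 / real (Suc n)" k]
        by (subst inverse_ennreal) (auto simp: inverse_eq_divide)
      ultimately show ?thesis by (simp add: divide_ennreal_def)
    qed
  qed measurable
  then show ?thesis by (simp only: eq nn_integral_scaled_symb[OF assms])
qed

end

section \<open>Transience\<close>

context walk_kernel
begin

text \<open>The generator acts on Fourier coefficients as multiplication by \<open>- q symb\<close>, and the
  indicator of the origin has the constant transform 1.\<close>

lemma generator_iterate:
  "((\<lambda>f u. q * walk_op a f u) ^^ m) (indicator {0}) = ft (\<lambda>k. (- q * symb k) ^ m)"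
proof (induction m)
  case 0
  show ?case by (simp add: fun_eq_iff ft_one)
next
  case (Suc m)
  define G where "G = (\<lambda>k. (- q * symb k) ^ m)"
  define M where "M = (\<bar>q\<bar> * 2) ^ m"
  have G: "G \<in> borel_measurable borel" unfolding G_def by measurable
  have Gb: "\<bar>G k\<bar> \<le> M" for k
    unfolding G_def M_def power_abs using symb_bounds[of k]
    by (intro power_mono) (auto simp: abs_mult intro!: mult_left_mono)
  have aG: "(\<lambda>k. a_hat a k * G k) \<in> borel_measurable borel" using G by measurable
  have aGb: "\<bar>a_hat a k * G k\<bar> \<le> M" for k
    using mult_mono[OF a_hat_abs_le[of k] Gb[of k]] by (simp add: abs_mult)
  have step: "q * walk_op a (ft G) u = ft (\<lambda>k. (- q * symb k) ^ Suc m) u" for u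
  proof -
    have "q * walk_op a (ft G) u = q * ft (\<lambda>k. a_hat a k * G k) u + (- q) * ft G u"
    proof -
      have "walk_op a (ft G) u = avg (ft G) u - ft G u"
        by (rule walk_op_eq[of _ M]) (use ft_bound[OF G Gb] in simp)
      then show ?thesis by (simp only: avg_ft[OF G Gb]) (simp add: right_diff_distrib)
    qed
    also have "\<dots> = ft (\<lambda>k. q * (a_hat a k * G k) + (- q) * G k) u"
      by (rule ft_lincomb[OF aG aGb G Gb, symmetric])
    also have "(\<lambda>k. q * (a_hat a k * G k) + (- q) * G k) = (\<lambda>k. (- q * symb k) ^ Suc m)"
      by (auto simp: G_def symb_def algebra_simps)
    finally show ?thesis .
  qed
  show ?case by (simp only: funpow.simps comp_apply Suc.IH step[unfolded G_def])
qed

lemma exp_decay_integrable: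
  "q > 0 \<Longrightarrow> t \<ge> 0 \<Longrightarrow> integrable tor (\<lambda>k. exp (- (t * (q * symb k))))"
  by (rule integrable_tor[of _ 1]) (auto simp: symb_bounds)

text \<open>The exponential series, integrated term by term.\<close>

lemma transition_prob_eq:
  assumes "\<kappa> > 0" "t \<ge> 0"
  shows "transition_prob \<kappa> a t 0 0 = (\<integral>k. exp (- (t * (2 * \<kappa> * symb k))) \<partial>tor)"
proof -
  define q where "q = 2 * \<kappa>"
  have q: "q > 0" using assms by (simp add: q_def)
  define f where "f = (\<lambda>m k. t ^ m / fact m * (- q * symb k) ^ m)"
  have f_meas: "f m \<in> borel_measurable borel" for m unfolding f_def by measurable
  have f_bd: "norm (f m k) \<le> (t * (q * 2)) ^ m / fact m" for m k
  proof -
    have "norm (f m k) = (t * (q * symb k)) ^ m / fact m"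
      using assms q symb_bounds[of k] by (simp add: f_def abs_mult power_abs power_mult_distrib)
    also have "\<dots> \<le> (t * (q * 2)) ^ m / fact m"
      using assms q symb_bounds[of k] by (intro divide_right_mono power_mono mult_left_mono) auto
    finally show ?thesis .
  qed
  have summ: "summable (\<lambda>m. (t * (q * 2)) ^ m / fact m)"
    using summable_exp[of "t * (q * 2)"] by (simp add: field_simps)
  have f_int: "integrable tor (f m)" for m by (rule integrable_tor[OF f_meas f_bd])
  have f_sum: "(\<Sum>m. f m k) = exp (- (t * (q * symb k)))" for k
    unfolding exp_def by (intro suminf_cong) (simp add: f_def power_mult_distrib[symmetric] field_simps)
  have "transition_prob \<kappa> a t 0 0 = (\<Sum>m. t ^ m / fact m * ft (\<lambda>k. (- q * symb k) ^ m) 0)"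
    unfolding transition_prob_def q_def generator_iterate ..
  also have "\<dots> = (\<Sum>m. \<integral>k. f m k \<partial>tor)"
    by (simp add: ft_def f_def)
  also have "\<dots> = (\<integral>k. (\<Sum>m. f m k) \<partial>tor)"
  proof (rule integral_suminf[symmetric])
    show "AE k in tor. summable (\<lambda>m. norm (f m k))"
      using f_bd by (intro AE_I2 summable_comparison_test'[OF summ]) auto
    show "summable (\<lambda>m. \<integral>k. norm (f m k) \<partial>tor)"
    proof (rule summable_comparison_test'[OF summ])
      fix m
      show "norm (\<integral>k. norm (f m k) \<partial>tor) \<le> (t * (q * 2)) ^ m / fact m"
        unfolding real_norm_def[of "integral\<^sup>L _ _"]
        by (rule integral_tor_bound) (use f_meas f_bd in auto)
    qed
  qed (rule f_int)
  finally show ?thesis by (simp add: f_sum q_def)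
qed

lemma nn_integral_exp_decay:
  assumes "w \<ge> 0"
  shows "(\<integral>\<^sup>+t\<in>{0..}. ennreal (exp (- (t * w))) \<partial>lborel) = 1 / ennreal w"
proof (cases "w = 0")
  case True
  have "emeasure lborel {0::real..} = top"
  proof (rule top_le)
    have "of_nat n \<le> emeasure lborel {0::real..}" for n
      using emeasure_mono[of "{0..real n}" "{0..}" lborel] by (simp add: ennreal_of_nat_eq_real_of_nat)
    then have "(SUP n. of_nat n) \<le> emeasure lborel {0::real..}" by (rule SUP_least)
    then show "top \<le> emeasure lborel {0::real..}" by (simp add: ennreal_SUP_of_nat_eq_top)
  qed
  then show ?thesis using True by simp
next
  case False
  then have w: "w > 0" using assms by simp
  have deriv: "((\<lambda>t. - exp (- (t * w)) / w) has_real_derivative exp (- (t * w))) (at t)" for t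
    using w by (auto intro!: derivative_eq_intros)
  have lim: "((\<lambda>t. - exp (- (t * w)) / w) \<longlongrightarrow> 0) at_top"
    using w by real_asymp
  have "(\<integral>\<^sup>+t. ennreal (exp (- (t * w))) * indicator {0..} t \<partial>lborel) = ennreal (0 - (- exp (- (0 * w)) / w))"
    by (rule nn_integral_FTC_atLeast[OF _ deriv _ lim]) auto
  then show ?thesis using w by (simp add: divide_ennreal flip: ennreal_1)
qed

text \<open>Tonelli's theorem: integrating \<open>exp (- t q symb k)\<close> over time gives \<open>1 / (q symb k)\<close>,
  also where \<open>symb k = 0\<close> and both sides are infinite.\<close>

lemma transient_iff:
  assumes "\<kappa> > 0"
  shows "transient \<kappa> a \<longleftrightarrow> torus_integral a < \<infinity>"
proof -
  define q where "q = 2 * \<kappa>"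
  have q: "q > 0" using assms by (simp add: q_def)
  define f where "f = (\<lambda>k t. ennreal (exp (- (t * (q * symb k)))) * indicator {0..} t)"
  interpret P: pair_sigma_finite "tor :: (real ^ 'n) measure" "lborel :: real measure" ..
  have "(\<integral>\<^sup>+t\<in>{0..}. ennreal (transition_prob \<kappa> a t 0 0) \<partial>lborel) = (\<integral>\<^sup>+t. (\<integral>\<^sup>+k. f k t \<partial>tor) \<partial>lborel)"
  proof (rule nn_integral_cong)
    fix t :: real
    show "ennreal (transition_prob \<kappa> a t 0 0) * indicator {0..} t = (\<integral>\<^sup>+k. f k t \<partial>tor)"
    proof (cases "t \<ge> 0")
      case True
      have "ennreal (transition_prob \<kappa> a t 0 0) = (\<integral>\<^sup>+k. ennreal (exp (- (t * (q * symb k)))) \<partial>tor)"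
        unfolding transition_prob_eq[OF assms True] q_def[symmetric]
        by (rule nn_integral_eq_integral[symmetric]) (use exp_decay_integrable[OF q True] in auto)
      then show ?thesis using True by (simp add: f_def)
    qed (simp add: f_def)
  qed
  also have "\<dots> = (\<integral>\<^sup>+k. (\<integral>\<^sup>+t. f k t \<partial>lborel) \<partial>tor)"
    by (rule P.Fubini') (unfold f_def, measurable)
  also have "\<dots> = (\<integral>\<^sup>+k. 1 / ennreal (q * symb k) \<partial>tor)"
    unfolding f_def using nn_integral_exp_decay[of "q * symb k" for k] q symb_bounds
    by (intro nn_integral_cong) auto
  also have "\<dots> = ennreal (1 / q) * torus_mean" by (rule nn_integral_scaled_symb[OF q])
  finally have "transient \<kappa> a \<longleftrightarrow> ennreal (1 / q) * torus_mean < \<infinity>"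
    by (simp add: transient_def)
  also have "\<dots> \<longleftrightarrow> torus_mean < \<infinity>"
    using q by (auto simp: ennreal_mult_less_top)
  finally show ?thesis using torus_mean_finite_iff by simp
qed

section \<open>The critical coupling\<close>

lemma avg_of_real:
  fixes f :: "int ^ 'n \<Rightarrow> real"
  assumes "\<And>x. \<bar>f x\<bar> \<le> M"
  shows "avg (\<lambda>x. complex_of_real (f x)) x = of_real (avg f x)"
proof -
  have "((\<lambda>z. a z *\<^sub>R f (x + z)) has_sum avg f x) UNIV"
    by (rule avg_has_sum[of _ M]) (use assms in simp)
  then have "((\<lambda>z. complex_of_real (a z *\<^sub>R f (x + z))) has_sum of_real (avg f x)) UNIV"
    by (rule has_sum_of_real)
  then show ?thesis
    unfolding avg_def[of "\<lambda>x. complex_of_real (f x)"] by (intro infsumI) (simp add: scaleR_conv_of_real)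
qed

lemma positive_spectrum_iff:
  assumes "\<kappa> > 0" "\<mu> > 0"
  shows "of_real \<mu> \<in> l2_spectrum (schroedinger_op \<kappa> a (indicator {0})) \<longleftrightarrow> green (2 * \<kappa>) \<mu> = 1"
proof -
  have q: "2 * \<kappa> > 0" using assms by simp
  define u where "u = ft (\<lambda>k. 1 / (\<mu> + 2 * \<kappa> * symb k))"
  note sol = green_solution[OF q assms(2), folded u_def]
  have "of_real (\<mu> + 2 * \<kappa>) * complex_of_real (u x)
      = of_real (2 * \<kappa>) * avg (\<lambda>x. complex_of_real (u x)) x + indicator {0} x" for x
  proof -
    have "of_real (\<mu> + 2 * \<kappa>) * complex_of_real (u x) = of_real ((\<mu> + 2 * \<kappa>) * u x)" by simp
    also have "\<dots> = of_real (2 * \<kappa> * avg u x + indicator {0} x)" by (simp only: sol(2))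
    also have "\<dots> = of_real (2 * \<kappa>) * of_real (avg u x) + indicator {0} x"
      by (simp add: indicator_def)
    finally show ?thesis by (simp only: avg_of_real[of u, OF sol(1)])
  qed
  then have "of_real \<mu> \<in> l2_spectrum (schroedinger_op \<kappa> a (indicator {0})) \<longleftrightarrow> complex_of_real (u 0) = 1"
    using sol(1) by (intro spectrum_iff[OF assms, of _ "1 / \<mu>"]) auto
  then show ?thesis using sol(3) by simp
qed

text \<open>The Green function decreases strictly from the limit \<open>g / q > 1\<close> at 0 to the limit 0 at
  infinity, so it takes the value 1 exactly once on the positive axis, at the largest point of
  the spectrum.\<close>

lemma spectrum_max_subcritical:
  assumes "\<kappa> > 0" "torus_mean = ennreal g" "2 * \<kappa> < g"
  shows "spectrum_max (schroedinger_op \<kappa> a (indicator {0})) > 0"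
proof -
  define q where "q = 2 * \<kappa>"
  have q: "q > 0" "q < g" using assms by (auto simp: q_def)
  have "ennreal (1 / q) * torus_mean = ennreal (g / q)"
    using q assms(2) by (simp add: ennreal_mult[symmetric])
  moreover have "ennreal 1 < ennreal (g / q)"
    using q by (subst ennreal_less_iff) (auto simp: field_simps)
  then have "ennreal (g / q) > 1" by simp
  moreover have "(\<lambda>n. ennreal (green q (1 / real (Suc n)))) \<longlonglongrightarrow> ennreal (1 / q) * torus_mean"
    by (rule green_tendsto_torus_mean[OF q(1)])
  ultimately have "\<forall>\<^sub>F n in sequentially. 1 < ennreal (green q (1 / real (Suc n)))"
    by (metis order_tendstoD(1))
  then obtain n where "ennreal (green q (1 / real (Suc n))) > 1"
    using eventually_happens by force
  then have big: "green q (1 / real (Suc n)) > 1"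
    using ennreal_leI[of "green q (1 / real (Suc n))" 1] by (force simp: not_le[symmetric])
  define \<mu>0 where "\<mu>0 = 1 / real (Suc n)"
  have \<mu>0: "0 < \<mu>0" "\<mu>0 \<le> 2" "1 \<le> green q \<mu>0"
    using big by (auto simp: \<mu>0_def field_simps)
  \<comment> \<open>Since \<open>green q \<mu> \<le> 1 / \<mu>\<close>, the value 1 is attained no later than at \<open>\<mu> = 2\<close>.\<close>
  have "green q 2 \<le> 1" using green_le[OF q(1), of 2] by simp
  then have "\<exists>\<mu>\<ge>\<mu>0. \<mu> \<le> 2 \<and> green q \<mu> = 1"
    using \<mu>0 continuous_on_subset[OF green_continuous[OF q(1) \<mu>0(1)], of "{\<mu>0..2}"]
    by (intro IVT2') auto
  then obtain \<mu> where "\<mu>0 \<le> \<mu>" and root: "green q \<mu> = 1" by blast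
  then have \<mu>: "\<mu> > 0" "green q \<mu> = 1" using \<mu>0(1) by auto
  have "spectrum_max (schroedinger_op \<kappa> a (indicator {0})) = \<mu>"
    unfolding spectrum_max_def
  proof (rule Greatest_equality)
    show "complex_of_real \<mu> \<in> l2_spectrum (schroedinger_op \<kappa> a (indicator {0}))"
      using positive_spectrum_iff[OF assms(1) \<mu>(1)] \<mu>(2) by (simp add: q_def)
    fix s assume s: "complex_of_real s \<in> l2_spectrum (schroedinger_op \<kappa> a (indicator {0}))"
    show "s \<le> \<mu>"
    proof (rule ccontr)
      assume "\<not> s \<le> \<mu>"
      then have "s > \<mu>" "s > 0" using \<mu>(1) by auto
      then have "green q s = 1" using positive_spectrum_iff[OF assms(1)] s by (simp add: q_def)
      then show False using green_strict_antimono[OF q(1) \<mu>(1) \<open>s > \<mu>\<close>] \<mu>(2) by simp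
    qed
  qed
  then show ?thesis using \<mu>(1) by simp
qed

lemma spectrum_max_supercritical:
  assumes "\<kappa> > 0" "torus_mean = ennreal g" "g \<ge> 0" "2 * \<kappa> > g"
  shows "spectrum_max (schroedinger_op \<kappa> a (indicator {0})) = 0"
  unfolding spectrum_max_def
proof (rule Greatest_equality)
  show "complex_of_real 0 \<in> l2_spectrum (schroedinger_op \<kappa> a (indicator {0}))"
    using zero_in_spectrum by simp
  fix s assume s: "complex_of_real s \<in> l2_spectrum (schroedinger_op \<kappa> a (indicator {0}))"
  show "s \<le> 0"
  proof (rule ccontr)
    assume "\<not> s \<le> 0"
    then have "s > 0" by simp
    then have "green (2 * \<kappa>) s = 1" using positive_spectrum_iff[OF assms(1)] s by simp
    moreover have "ennreal (green (2 * \<kappa>) s) \<le> ennreal (g / (2 * \<kappa>))"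
      using green_le_torus_mean[of "2 * \<kappa>" s] assms \<open>s > 0\<close> by (simp add: ennreal_mult[symmetric])
    then have "green (2 * \<kappa>) s \<le> g / (2 * \<kappa>)"
      using assms by (subst (asm) ennreal_le_iff) auto
    ultimately show False using assms by (simp add: field_simps)
  qed
qed

lemma torus_mean_pos: "torus_mean > 0"
proof -
  have "ennreal (1 / 2) = (\<integral>\<^sup>+k. ennreal (1 / 2) \<partial>(tor :: (real ^ 'n) measure))"
  proof -
    have "emeasure (tor :: (real ^ 'n) measure) UNIV = 1"
      by (subst space_tor[symmetric], rule tor.emeasure_space_1)
    then show ?thesis by simp
  qed
  also have "\<dots> \<le> torus_mean"
    unfolding torus_mean_def
  proof (rule nn_integral_mono)
    fix k
    show "ennreal (1 / 2) \<le> 1 / ennreal (symb k)"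
    proof (cases "symb k = 0")
      case False
      then have "symb k > 0" using symb_bounds[of k] by simp
      then have "1 / ennreal (symb k) = ennreal (1 / symb k)" by (simp add: divide_ennreal flip: ennreal_1)
      moreover have "ennreal (1 / 2) \<le> ennreal (1 / symb k)"
        using symb_bounds[of k] \<open>symb k > 0\<close> by (intro ennreal_leI divide_left_mono) auto
      ultimately show ?thesis by (simp only:)
    qed simp
  qed
  finally have "ennreal (1 / 2) \<le> torus_mean" .
  moreover have "0 < ennreal (1 / 2)" by (subst ennreal_less_zero_iff) simp
  ultimately show ?thesis by (rule less_le_trans[rotated])
qed

end

theorem theorem9p3:
  fixes a :: "int ^ 'n \<Rightarrow> real" and B :: "int ^ 'n \<Rightarrow> real"
  assumes "\<And>z. a z \<ge> 0"
    and "\<And>z. a (- z) = a z"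
    and "a 0 = 0"
    and "\<And>z. norm (lattice_vec z) = 1 \<Longrightarrow> a z > 0"
    and "(a has_sum 1) UNIV"
    and "B = indicator {0}"
  shows "(\<forall>\<kappa>>0. torus_integral a < \<infinity> \<longleftrightarrow> transient \<kappa> a) \<and>
    (torus_integral a < \<infinity> \<longrightarrow>
      (\<exists>\<kappa>cr>0. \<forall>\<kappa>>0.
        (\<kappa> < \<kappa>cr \<longrightarrow> spectrum_max (schroedinger_op \<kappa> a B) > 0) \<and>
        (\<kappa> > \<kappa>cr \<longrightarrow> spectrum_max (schroedinger_op \<kappa> a B) = 0)))"
proof -
  interpret walk_kernel a by standard (fact assms)+
  have crit: "\<exists>\<kappa>cr>0. \<forall>\<kappa>>0.
      (\<kappa> < \<kappa>cr \<longrightarrow> spectrum_max (schroedinger_op \<kappa> a B) > 0) \<and>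
      (\<kappa> > \<kappa>cr \<longrightarrow> spectrum_max (schroedinger_op \<kappa> a B) = 0)" if "torus_integral a < \<infinity>"
  proof -
    have "torus_mean < \<infinity>" using that torus_mean_finite_iff by simp
    then obtain g where g: "g \<ge> 0" "torus_mean = ennreal g"
      by (cases torus_mean) auto
    then have "g > 0" using torus_mean_pos by simp
    \<comment> \<open>Criticality is \<open>g / q = 1\<close> with \<open>q = 2\<kappa>\<close>.\<close>
    then show ?thesis
      using spectrum_max_subcritical[OF _ g(2)] spectrum_max_supercritical[OF _ g(2,1)]
      unfolding assms(6) by (intro exI[of _ "g / 2"]) auto
  qed
  then show ?thesis using transient_iff by blast
qed

end
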